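(* Let $G=(V,E,\pi)$ be a locally finite Borel graph and let $(A,B)$ be a Borel bipartition of $G$ that has combinatorial expansion. If $G$ is of subexponential growth, then $G$ has a Borel matching covering $A$.
   Context: A Borel graph (multigraph) is a triple $G=(V,E,\pi)$ where the vertex set $V$ and the edge set $E$ are standard Borel spaces and $\pi\colon E\to[V]^2$ is a Borel map sending each edge to its pair of endpoints; $[V]^2$ is the set of unordered pairs of distinct elements of $V$. Thus graphs are undirected and loopless, and parallel edges are allowed. $G$ is locally finite if every vertex is incident to finitely many edges. $N_G(x)$ is the set of neighbors of $x$, and $N_G(S)=\bigcup_{x\in S}N_G(x)$. A bipartition of $G$ is a partition $V=A\sqcup B$ such that every edge has one endpoint in $A$ and the other in $B$; it is Borel if $A$ and $B$ are Borel sets. It has combinatorial expansion if there is $c>1$ such that $|N_G(S)|\ge c|S|$ for every finite set $S\subseteq A$. For a vertex $x$ and $R>0$, $B_G(x,R)$ is the set of all vertices reachable from $x$ by a path of at most $R$ edges. $G$ is of subexponential growth if for all $\varepsilon>0$ there is $R_\varepsilon>0$ such that $|B_G(x,R)|\le e^{\varepsilon R}$ for all $R\ge R_\varepsilon$ and every vertex $x$. A matching is a set $M\subseteq E$ of edges whose endpoint sets are pairwise disjoint; it is Borel if it is a Borel subset of $E$. $M$ covers $A$ if every $x\in A$ is an endpoint of some edge in $M$. *)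

theory Defs
  imports "HOL-Analysis.Analysis"
begin

text \<open>
  Values of type \<open>'a measure\<close> serve here only as measurable spaces: a Borel space is given by
  \<^term>\<open>space M\<close> and \<^term>\<open>sets M\<close>, and the measure itself is never used.
\<close>

definition polish_topology :: "'a topology \<Rightarrow> bool" where
  "polish_topology X \<longleftrightarrow> completely_metrizable_space X \<and> separable_space X"

definition standard_borel :: "'a measure \<Rightarrow> bool" where
  "standard_borel M \<longleftrightarrow>
     (\<exists>X. polish_topology X \<and> space M = topspace X \<and>
          sets M = sigma_sets (topspace X) {U. openin X U})"

text \<open>
  The space \<open>[V]\<^sup>2\<close> of unordered pairs of distinct points carries the quotient Borel structure of
  the off-diagonal part of \<open>V \<times> V\<close>.
\<close>

definition distinct_pairs :: "'a measure \<Rightarrow> ('a \<times> 'a) measure" where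
  "distinct_pairs V = restrict_space (V \<Otimes>\<^sub>M V) {(x, y). x \<noteq> y}"

definition unordered_pairs :: "'a measure \<Rightarrow> 'a set measure" where
  "unordered_pairs V =
     sigma {{x, y} | x y. x \<in> space V \<and> y \<in> space V \<and> x \<noteq> y}
       {U. U \<subseteq> {{x, y} | x y. x \<in> space V \<and> y \<in> space V \<and> x \<noteq> y} \<and>
           (\<lambda>(x, y). {x, y}) -` U \<inter> space (distinct_pairs V) \<in> sets (distinct_pairs V)}"

lemma sigma_algebra_final:
  assumes f: "f \<in> space N \<rightarrow> X"
  shows "sigma_algebra X {U. U \<subseteq> X \<and> f -` U \<inter> space N \<in> sets N}" (is "sigma_algebra X ?A")
  unfolding sigma_algebra_iff2
proof (intro conjI ballI allI impI)
  show "?A \<subseteq> Pow X" by blast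
  show "{} \<in> ?A" by simp
next
  fix U assume U: "U \<in> ?A"
  have "f -` (X - U) \<inter> space N = space N - (f -` U \<inter> space N)"
    using f by auto
  also have "\<dots> \<in> sets N"
    using U by (intro sets.Diff sets.top) blast
  finally show "X - U \<in> ?A" by blast
next
  fix U :: "nat \<Rightarrow> 'b set" assume "range U \<subseteq> ?A"
  then have U: "U i \<subseteq> X" "f -` U i \<inter> space N \<in> sets N" for i by auto
  have "f -` (\<Union>i. U i) \<inter> space N = (\<Union>i. f -` U i \<inter> space N)" by auto
  also have "\<dots> \<in> sets N" using U(2) by (intro sets.countable_UN) blast
  finally show "(\<Union>i. U i) \<in> ?A" using U(1) by blast
qed

lemma space_unordered_pairs:
  "space (unordered_pairs V) = {{x, y} | x y. x \<in> space V \<and> y \<in> space V \<and> x \<noteq> y}"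
  unfolding unordered_pairs_def by (rule space_measure_of) auto

text \<open>The generating family in \<^const>\<open>unordered_pairs\<close> is already a \<open>\<sigma>\<close>-algebra.\<close>

lemma sets_unordered_pairs:
  "sets (unordered_pairs V) =
     {U. U \<subseteq> {{x, y} | x y. x \<in> space V \<and> y \<in> space V \<and> x \<noteq> y} \<and>
         (\<lambda>(x, y). {x, y}) -` U \<inter> space (distinct_pairs V) \<in> sets (distinct_pairs V)}"
proof -
  have "(\<lambda>(x, y). {x, y}) \<in> space (distinct_pairs V) \<rightarrow>
      {{x, y} | x y. x \<in> space V \<and> y \<in> space V \<and> x \<noteq> y}"
    by (auto simp: distinct_pairs_def space_restrict_space space_pair_measure)
  from sigma_algebra_final[OF this] show ?thesis
    unfolding unordered_pairs_def by (rule sigma_algebra.sets_measure_of_eq)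
qed

definition borel_graph :: "'v measure \<Rightarrow> 'e measure \<Rightarrow> ('e \<Rightarrow> 'v set) \<Rightarrow> bool" where
  "borel_graph V E \<pi> \<longleftrightarrow>
     standard_borel V \<and> standard_borel E \<and> \<pi> \<in> measurable E (unordered_pairs V)"

definition locally_finite_graph :: "'v measure \<Rightarrow> 'e measure \<Rightarrow> ('e \<Rightarrow> 'v set) \<Rightarrow> bool" where
  "locally_finite_graph V E \<pi> \<longleftrightarrow> (\<forall>x\<in>space V. finite {e \<in> space E. x \<in> \<pi> e})"

definition neighbors :: "'e measure \<Rightarrow> ('e \<Rightarrow> 'v set) \<Rightarrow> 'v \<Rightarrow> 'v set" where
  "neighbors E \<pi> x = {y. \<exists>e\<in>space E. \<pi> e = {x, y}}"

definition neighborhood :: "'e measure \<Rightarrow> ('e \<Rightarrow> 'v set) \<Rightarrow> 'v set \<Rightarrow> 'v set" where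
  "neighborhood E \<pi> S = (\<Union>x\<in>S. neighbors E \<pi> x)"

definition borel_bipartition ::
  "'v measure \<Rightarrow> 'e measure \<Rightarrow> ('e \<Rightarrow> 'v set) \<Rightarrow> 'v set \<Rightarrow> 'v set \<Rightarrow> bool" where
  "borel_bipartition V E \<pi> A B \<longleftrightarrow>
     A \<in> sets V \<and> B \<in> sets V \<and> A \<union> B = space V \<and> A \<inter> B = {} \<and>
     (\<forall>e\<in>space E. \<exists>a\<in>A. \<exists>b\<in>B. \<pi> e = {a, b})"

text \<open>
  In the next definition and in that of subexponential growth, infinite sets are treated
  separately because \<^const>\<open>card\<close> is \<open>0\<close> on them; in a locally finite graph all the sets
  concerned are finite.
\<close>

definition combinatorial_expansion :: "'e measure \<Rightarrow> ('e \<Rightarrow> 'v set) \<Rightarrow> 'v set \<Rightarrow> bool" where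
  "combinatorial_expansion E \<pi> A \<longleftrightarrow>
     (\<exists>c::real. c > 1 \<and>
        (\<forall>S. finite S \<and> S \<subseteq> A \<longrightarrow>
           infinite (neighborhood E \<pi> S) \<or>
           real (card (neighborhood E \<pi> S)) \<ge> c * real (card S)))"

definition graph_ball :: "'e measure \<Rightarrow> ('e \<Rightarrow> 'v set) \<Rightarrow> 'v \<Rightarrow> real \<Rightarrow> 'v set" where
  "graph_ball E \<pi> x R =
     {y. \<exists>n::nat. real n \<le> R \<and> (x, y) \<in> {(u, v). v \<in> neighbors E \<pi> u} ^^ n}"

definition subexponential_growth :: "'v measure \<Rightarrow> 'e measure \<Rightarrow> ('e \<Rightarrow> 'v set) \<Rightarrow> bool" where
  "subexponential_growth V E \<pi> \<longleftrightarrow>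
     (\<forall>\<epsilon>::real. \<epsilon> > 0 \<longrightarrow>
        (\<exists>R0::real. R0 > 0 \<and>
           (\<forall>R\<ge>R0. \<forall>x\<in>space V.
              finite (graph_ball E \<pi> x R) \<and>
              real (card (graph_ball E \<pi> x R)) \<le> exp (\<epsilon> * R))))"

definition borel_matching :: "'e measure \<Rightarrow> ('e \<Rightarrow> 'v set) \<Rightarrow> 'e set \<Rightarrow> bool" where
  "borel_matching E \<pi> M \<longleftrightarrow> M \<in> sets E \<and> pairwise (\<lambda>e f. disjnt (\<pi> e) (\<pi> f)) M"

definition matching_covers :: "('e \<Rightarrow> 'v set) \<Rightarrow> 'e set \<Rightarrow> 'v set \<Rightarrow> bool" where
  "matching_covers \<pi> M A \<longleftrightarrow> (\<forall>x\<in>A. \<exists>e\<in>M. x \<in> \<pi> e)"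

end

theory Submission
  imports Defs
begin

text \<open>
  Write \<open>s e \<in> A\<close> and \<open>t e \<in> B\<close> for the endpoints of an edge \<open>e\<close>. If a matching admits no augmenting
  path with at most \<open>2 * k + 1\<close> edges, then by expansion the alternating walks of length \<open>2 * k\<close> from an
  unmatched vertex of \<open>A\<close> reach at least \<open>c ^ k\<close> vertices, which contradicts subexponential growth
  for large \<open>k\<close>. So it suffices to find, for every \<open>k\<close>, a Borel matching without short augmenting
  paths. As in the Hopcroft--Karp algorithm, this is done in phases of increasing path length: in
  one phase every edge changes its status at most once, so countably many simultaneous
  augmentations, one for every word of colours in a countable Borel edge colouring, converge
  to a Borel matching. That all sets involved are Borel rests on the fact that \<open>s\<close> and \<open>t\<close>,
  being finite-to-one, map Borel sets to Borel sets; this is derived from Novikov's separation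
  theorem.
\<close>

section \<open>Codings of standard Borel spaces\<close>

text \<open>Convergence is the obstacle: under infinitely many augmentations an edge could change
  its status infinitely often, and there is no measure for which the bad edges would be null. A
  phase avoids this because one pair of integer potentials stays valid throughout it and alone
  determines the direction in which an edge may move. The potentials are mere certificates,
  arbitrary functions on the vertices; in the phases Borel operations are applied to edge sets only.

  Finitely many phases suffice, because the radius in the definition of subexponential growth is the
  same for all vertices. Thus no limit over the phases has to be controlled.

  Codings replace topology: a complete coding plays the part of a finer, zero-dimensional Polish
  topology, and refining it makes prescribed Borel sets clopen.\<close>

text \<open>
  A complete coding is a Borel map into the Baire space with closed range.
\<close>

definition complete_coding :: "'a measure \<Rightarrow> ('i \<Rightarrow> 'a \<Rightarrow> nat) \<Rightarrow> bool" where
  "complete_coding M c \<longleftrightarrow>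
     (\<forall>i. c i \<in> measurable M (count_space UNIV)) \<and>
     (\<forall>\<alpha>. (\<forall>F. finite F \<longrightarrow> (\<exists>x\<in>space M. \<forall>i\<in>F. c i x = \<alpha> i)) \<longrightarrow>
        (\<exists>x\<in>space M. \<forall>i. c i x = \<alpha> i))"

text \<open>These sets are clopen in the topology pulled back along \<open>c\<close>. With a single
  coordinate, agreement at one index settles membership.\<close>

definition decides :: "'a measure \<Rightarrow> ('i \<Rightarrow> 'a \<Rightarrow> nat) \<Rightarrow> 'a set \<Rightarrow> bool" where
  "decides M c Q \<longleftrightarrow> (\<exists>i S. Q = {x \<in> space M. c i x \<in> S})"

lemma complete_codingI:
  assumes "\<And>i. c i \<in> measurable M (count_space UNIV)"
    and "\<And>\<alpha>. (\<And>F. finite F \<Longrightarrow> \<exists>x\<in>space M. \<forall>i\<in>F. c i x = \<alpha> i) \<Longrightarrow>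
      \<exists>x\<in>space M. \<forall>i. c i x = \<alpha> i"
  shows "complete_coding M c"
  unfolding complete_coding_def using assms by blast

lemma complete_coding_measurable [measurable_dest]:
  "complete_coding M c \<Longrightarrow> c i \<in> measurable M (count_space UNIV)"
  by (simp add: complete_coding_def)

lemma complete_codingD:
  assumes "complete_coding M c"
    and "\<And>F. finite F \<Longrightarrow> \<exists>x\<in>space M. \<forall>i\<in>F. c i x = \<alpha> i"
  shows "\<exists>x\<in>space M. \<forall>i. c i x = \<alpha> i"
  using assms unfolding complete_coding_def by blast

lemma decidesI: "Q = {x \<in> space M. c i x \<in> S} \<Longrightarrow> decides M c Q"
  by (auto simp: decides_def)

lemma decidesE:
  assumes "decides M c Q"
  obtains i where "Q \<subseteq> space M"
    and "\<And>x y. x \<in> space M \<Longrightarrow> y \<in> space M \<Longrightarrow> c i x = c i y \<Longrightarrow> x \<in> Q \<longleftrightarrow> y \<in> Q"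
proof -
  from assms obtain i S where "Q = {x \<in> space M. c i x \<in> S}" by (auto simp: decides_def)
  then show thesis using that[of i] by auto
qed

lemma decides_Compl: "decides M c Q \<Longrightarrow> decides M c (space M - Q)"
proof -
  assume "decides M c Q"
  then obtain i S where "Q = {x \<in> space M. c i x \<in> S}" by (auto simp: decides_def)
  then show ?thesis by (intro decidesI[of _ _ _ i "- S"]) auto
qed

lemma complete_coding_reindex:
  fixes c :: "'i::countable \<Rightarrow> 'a \<Rightarrow> nat"
  assumes c: "complete_coding M c"
  shows "complete_coding M (\<lambda>n. c (from_nat n))"
proof (rule complete_codingI)
  fix i show "c (from_nat i) \<in> measurable M (count_space UNIV)" using c by measurable
next
  fix \<alpha> :: "nat \<Rightarrow> nat"
  assume fin: "\<And>F. finite F \<Longrightarrow> \<exists>x\<in>space M. \<forall>i\<in>F. c (from_nat i) x = \<alpha> i"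
  have "\<exists>x\<in>space M. \<forall>i. c i x = \<alpha> (to_nat i)"
  proof (rule complete_codingD[OF c])
    fix F :: "'i set" assume "finite F"
    then have "finite (to_nat ` F)" by simp
    from fin[OF this] show "\<exists>x\<in>space M. \<forall>i\<in>F. c i x = \<alpha> (to_nat i)" by auto
  qed
  then obtain x where x: "x \<in> space M" "\<And>i. c i x = \<alpha> (to_nat i)" by blast
  \<comment> \<open>Several numbers may decode to the same index; a common approximant shows that
    \<alpha> agrees on them.\<close>
  have "c (from_nat n) x = \<alpha> n" for n
  proof -
    obtain y where "y \<in> space M" "\<forall>i\<in>{n, to_nat (from_nat n :: 'i)}. c (from_nat i) y = \<alpha> i"
      using fin[of "{n, to_nat (from_nat n :: 'i)}"] by auto
    then show ?thesis using x(2)[of "from_nat n"] by auto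
  qed
  then show "\<exists>x\<in>space M. \<forall>i. c (from_nat i) x = \<alpha> i" using x(1) by blast
qed

lemma decides_reindex:
  fixes c :: "'i::countable \<Rightarrow> 'a \<Rightarrow> nat"
  assumes "decides M c Q"
  shows "decides M (\<lambda>n. c (from_nat n)) Q"
proof -
  from assms obtain i S where "Q = {x \<in> space M. c i x \<in> S}" by (auto simp: decides_def)
  then show ?thesis by (intro decidesI[of _ _ _ "to_nat i" S]) auto
qed

text \<open>
  \<open>a k x\<close> is the first centre at distance less than \<open>\<rho> k\<close> from \<open>x\<close>. Membership of \<open>x\<close> in an
  open ball is not preserved under limits; therefore \<open>m\<close> also records a finite stage at which the
  centres \<open>a n x\<close> witness it.
\<close>

lemma (in Metric_space) mball_coding:
  fixes u :: "nat \<Rightarrow> 'a" and N :: "'a measure" and \<rho> :: "nat \<Rightarrow> real"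
  assumes complete: mcomplete and u: "range u \<subseteq> M" and dense: "mtopology closure_of (range u) = M"
    and N: "space N = M" and balls: "\<And>x r. mball x r \<in> sets N"
    and \<rho>: "\<And>k. \<rho> k > 0" "decseq \<rho>" "\<And>e. e > 0 \<Longrightarrow> \<exists>n. \<rho> n < e"
  shows "\<exists>c :: nat + nat \<times> nat \<Rightarrow> 'a \<Rightarrow> nat. complete_coding N c \<and>
           (\<forall>i k. decides N c (mball (u i) (\<rho> k)))"
proof -
  define C where "C i k = mball (u i) (\<rho> k)" for i k :: nat
  have C_sets [measurable]: "C i k \<in> sets N" for i k unfolding C_def by (rule balls)
  have uM [simp]: "u i \<in> M" for i using u by auto
  have ex: "\<exists>i. x \<in> C i k" if "x \<in> M" for x k
  proof -
    have "x \<in> mtopology closure_of (range u)" using dense that by simp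
    moreover have "0 < \<rho> k" by (rule \<rho>(1))
    ultimately show ?thesis
      unfolding metric_closure_of C_def by (fastforce simp: commute)
  qed
  define a where "a k x = (LEAST i. x \<in> C i k)" for k x
  define m where "m i k x =
    (if x \<in> C i k then Suc (LEAST n. d (u (a n x)) (u i) + \<rho> n < \<rho> k) else 0)" for i k x
  have a: "x \<in> C (a k x) k" if "x \<in> M" for x k
    unfolding a_def using ex[OF that] by (rule LeastI_ex)
  have da: "d (u (a k x)) x < \<rho> k" if "x \<in> M" for x k
    using a[OF that, of k] by (simp add: C_def)
  have m_ex: "\<exists>n. d (u (a n x)) (u i) + \<rho> n < \<rho> k" if "x \<in> C i k" for x i k
  proof -
    have x: "x \<in> M" "d (u i) x < \<rho> k" using that by (auto simp: C_def)
    obtain n where "2 * \<rho> n < \<rho> k - d (u i) x"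
      using \<rho>(3)[of "(\<rho> k - d (u i) x) / 2"] x by (auto simp: mult.commute)
    moreover have "d (u (a n x)) (u i) \<le> d (u (a n x)) x + d x (u i)"
      using x by (intro triangle) auto
    ultimately have "d (u (a n x)) (u i) + \<rho> n < \<rho> k"
      using da[OF x(1), of n] commute[of x "u i"] by linarith
    then show ?thesis by blast
  qed
  define c where "c = (\<lambda>j. case j of Inl k \<Rightarrow> a k | Inr (i, k) \<Rightarrow> m i k)"
  have [measurable]: "a k \<in> measurable N (count_space UNIV)" for k
    unfolding a_def by measurable
  have [measurable]: "m i k \<in> measurable N (count_space UNIV)" for i k
    unfolding m_def by measurable
  have dec: "decides N c (C i k)" for i k
    by (rule decidesI[of _ _ _ "Inr (i, k)" "- {0}"]) (auto simp: c_def m_def N C_def)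
  have "complete_coding N c"
  proof (rule complete_codingI)
    show "c j \<in> measurable N (count_space UNIV)" for j
      by (cases j) (auto simp: c_def split: prod.split)
  next
    fix \<alpha> :: "nat + nat \<times> nat \<Rightarrow> nat"
    assume fin: "\<And>F. finite F \<Longrightarrow> \<exists>x\<in>space N. \<forall>j\<in>F. c j x = \<alpha> j"
    define v where "v k = u (\<alpha> (Inl k))" for k
    have vM [simp]: "v k \<in> M" for k by (simp add: v_def)
    have approx: "\<exists>y\<in>M. (\<forall>k\<le>n. a k y = \<alpha> (Inl k)) \<and> (\<forall>(i, k)\<in>F. m i k y = \<alpha> (Inr (i, k)))"
      if "finite F" for n F
    proof -
      have "finite (Inl ` {..n} \<union> Inr ` F)" using that by auto
      from fin[OF this] obtain y where "y \<in> M"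
        "\<forall>j\<in>Inl ` {..n} \<union> Inr ` F. c j y = \<alpha> j" using N by auto
      then show ?thesis by (intro bexI[of _ y]) (auto simp: c_def ball_Un)
    qed
    have vv: "d (v k) (v l) < \<rho> k + \<rho> l" for k l
    proof -
      obtain y where y: "y \<in> M" "a k y = \<alpha> (Inl k)" "a l y = \<alpha> (Inl l)"
        using approx[of "{}" "max k l"] by auto
      have "d (v k) (v l) \<le> d (v k) y + d y (v l)" using y by (intro triangle) auto
      then show ?thesis using da[OF y(1), of k] da[OF y(1), of l] y
        by (simp add: v_def commute)
    qed
    have "MCauchy v"
      unfolding MCauchy_def
    proof (intro conjI allI impI)
      show "range v \<subseteq> M" by auto
      fix e :: real assume "e > 0"
      then obtain n where n: "\<rho> n < e/2" using \<rho>(3)[of "e/2"] by auto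
      have "d (v k) (v l) < e" if "n \<le> k" "n \<le> l" for k l
      proof -
        have "\<rho> k \<le> \<rho> n" "\<rho> l \<le> \<rho> n"
          using that \<rho>(2) by (auto simp: decseq_def)
        then show ?thesis using vv[of k l] n by linarith
      qed
      then show "\<exists>N. \<forall>n n'. N \<le> n \<longrightarrow> N \<le> n' \<longrightarrow> d (v n) (v n') < e" by blast
    qed
    then obtain x where lim: "limitin mtopology v x sequentially"
      using complete unfolding mcomplete_def by blast
    then have x: "x \<in> M" by (simp add: limitin_metric)
    have vx: "d (v k) x \<le> \<rho> k" for k
    proof (rule field_le_epsilon)
      fix e :: real assume "e > 0"
      then obtain n1 where n1: "\<And>n. n \<ge> n1 \<Longrightarrow> d (v n) x < e/2"
        using lim unfolding limit_metric_sequentially by (metis half_gt_zero)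
      obtain n2 where n2: "\<rho> n2 < e/2" using \<rho>(3)[of "e/2"] \<open>e > 0\<close> by auto
      define n where "n = max n1 n2"
      have "\<rho> n \<le> \<rho> n2" using \<rho>(2) by (auto simp: n_def decseq_def)
      moreover have "d (v k) x \<le> d (v k) (v n) + d (v n) x" using x by (intro triangle) auto
      ultimately show "d (v k) x \<le> \<rho> k + e"
        using n1[of n] n2 vv[of k n] by (simp add: n_def)
    qed
    have xC: "x \<in> C i k \<longleftrightarrow> \<alpha> (Inr (i, k)) \<noteq> 0" for i k
    proof
      assume "x \<in> C i k"
      then have dx: "d x (u i) < \<rho> k" by (simp add: C_def commute)
      then obtain n where n: "2 * \<rho> n < \<rho> k - d x (u i)"
        using \<rho>(3)[of "(\<rho> k - d x (u i)) / 2"] by (auto simp: mult.commute)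
      obtain y where y: "y \<in> M" "a n y = \<alpha> (Inl n)" "m i k y = \<alpha> (Inr (i, k))"
        using approx[of "{(i, k)}" n] by auto
      have "d y (u i) \<le> d y (v n) + d (v n) (u i)" using y by (intro triangle) auto
      moreover have "d (v n) (u i) \<le> d (v n) x + d x (u i)" using x by (intro triangle) auto
      moreover have "d (v n) y < \<rho> n" using da[OF y(1), of n] y(2) by (simp add: v_def)
      ultimately have "d y (u i) < \<rho> k"
        using vx[of n] n commute[of y "v n"] by linarith
      then have "y \<in> C i k" using y by (simp add: C_def commute)
      then show "\<alpha> (Inr (i, k)) \<noteq> 0" using y by (simp add: m_def split: if_splits)
    next
      \<comment> \<open>A positive code names a stage \<open>n\<close> with
        \<open>d (v n) (u i) + \<rho> n < \<rho> k\<close>. Only coded data occur in this strict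
        inequality, so \<open>d (v n) x \<le> \<rho> n\<close> places the limit in the open
        ball.\<close>
      assume nz: "\<alpha> (Inr (i, k)) \<noteq> 0"
      then obtain n where n: "\<alpha> (Inr (i, k)) = Suc n" by (cases "\<alpha> (Inr (i, k))") auto
      obtain y where y: "y \<in> M" "a n y = \<alpha> (Inl n)" "m i k y = \<alpha> (Inr (i, k))"
        using approx[of "{(i, k)}" n] by auto
      have yC: "y \<in> C i k" using y nz by (auto simp: m_def split: if_splits)
      have "n = (LEAST n. d (u (a n y)) (u i) + \<rho> n < \<rho> k)"
        using y n yC by (simp add: m_def)
      then have "d (u (a n y)) (u i) + \<rho> n < \<rho> k"
        using LeastI_ex[OF m_ex[OF yC]] by simp
      then have "d (v n) (u i) + \<rho> n < \<rho> k" using y by (simp add: v_def)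
      moreover have "d x (u i) \<le> d x (v n) + d (v n) (u i)" using x by (intro triangle) auto
      ultimately show "x \<in> C i k" using vx[of n] x by (simp add: C_def commute)
    qed
    have ax: "a k x = \<alpha> (Inl k)" for k
    proof -
      \<comment> \<open>The range of indices covers both candidate minima, so that each competes in
        the definition of the other.\<close>
      obtain y where y: "y \<in> M" "a k y = \<alpha> (Inl k)"
        "\<And>i. i \<le> max (\<alpha> (Inl k)) (a k x) \<Longrightarrow> m i k y = \<alpha> (Inr (i, k))"
        using approx[of "(\<lambda>i. (i, k)) ` {..max (\<alpha> (Inl k)) (a k x)}" k] by fastforce
      have eq: "x \<in> C i k \<longleftrightarrow> y \<in> C i k" if "i \<le> max (\<alpha> (Inl k)) (a k x)" for i
        using y(3)[OF that] xC[of i k] by (auto simp: m_def split: if_splits)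
      have "a k y \<le> a k x"
        unfolding a_def[of k y] using eq[of "a k x"] a[OF x, of k] by (intro Least_le) simp
      moreover have "a k x \<le> a k y"
        unfolding a_def[of k x] using eq[of "a k y"] a[OF y(1), of k] y(2) by (intro Least_le) simp
      ultimately show ?thesis using y(2) by simp
    qed
    have mx: "m i k x = \<alpha> (Inr (i, k))" for i k
    proof (cases "x \<in> C i k")
      case False
      then show ?thesis using xC by (simp add: m_def)
    next
      case True
      define P where "P z n \<longleftrightarrow> d (u (a n z)) (u i) + \<rho> n < \<rho> k" for z n
      define l where "l = (LEAST n. P x n)"
      obtain y where y: "y \<in> M" "m i k y = \<alpha> (Inr (i, k))"
        "\<And>n. n \<le> max l (\<alpha> (Inr (i, k))) \<Longrightarrow> a n y = \<alpha> (Inl n)"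
        using approx[of "{(i, k)}" "max l (\<alpha> (Inr (i, k)))"] by auto
      have yC: "y \<in> C i k" using y xC True by (auto simp: m_def split: if_splits)
      define l' where "l' = (LEAST n. P y n)"
      have l': "\<alpha> (Inr (i, k)) = Suc l'"
        using y(2) yC by (simp add: m_def l'_def P_def)
      have P: "P x n \<longleftrightarrow> P y n" if "n \<le> max l (\<alpha> (Inr (i, k)))" for n
        using y(3)[OF that] ax[of n] by (simp add: P_def)
      have "P x l" unfolding l_def by (rule LeastI_ex) (use m_ex[OF True] in \<open>simp add: P_def\<close>)
      then have "l' \<le> l" unfolding l'_def using P[of l] by (intro Least_le) simp
      moreover have "P y l'"
        unfolding l'_def by (rule LeastI_ex) (use m_ex[OF yC] in \<open>simp add: P_def\<close>)
      then have "l \<le> l'" unfolding l_def using P[of l'] l' by (intro Least_le) simp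
      ultimately show ?thesis using l' True by (simp add: m_def l_def P_def)
    qed
    have "c j x = \<alpha> j" for j
      by (cases j) (auto simp: c_def ax mx split: prod.split)
    then show "\<exists>x\<in>space N. \<forall>j. c j x = \<alpha> j" using x N by blast
  qed
  then show ?thesis using dec unfolding C_def by blast
qed

lemma decides_sets:
  assumes "complete_coding M c" and "decides M c Q"
  shows "Q \<in> sets M"
proof -
  from assms(2) obtain i S where Q: "Q = {x \<in> space M. c i x \<in> S}" by (auto simp: decides_def)
  have "c i -` S \<inter> space M \<in> sets M"
    using complete_coding_measurable[OF assms(1), of i] by (rule measurable_sets) simp
  also have "c i -` S \<inter> space M = Q" using Q by auto
  finally show ?thesis .
qed

text \<open>Balls of radius \<open>(1/2) ^ k\<close> about a countable dense set form a base, and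
  \<open>mball_coding\<close> decides all of them at once. An empty space has no such centres and is
  treated apart.\<close>

lemma standard_borel_base:
  assumes "standard_borel M"
  obtains C :: "nat \<Rightarrow> 'a set" and c :: "nat \<Rightarrow> 'a \<Rightarrow> nat"
  where "complete_coding M c" and "\<And>j. decides M c (C j)"
    and "\<And>x y. x \<in> space M \<Longrightarrow> y \<in> space M \<Longrightarrow> (\<And>j. x \<in> C j \<longleftrightarrow> y \<in> C j) \<Longrightarrow> x = y"
    and "sets M = sigma_sets (space M) (range C)"
proof (cases "space M = {}")
  case True
  then have M: "sets M = {{}}" by (simp add: space_empty_iff)
  have "complete_coding M (\<lambda>(_::nat) _. 0)"
    by (rule complete_codingI) (use True in \<open>auto intro: finite.emptyI\<close>)
  moreover have "decides M (\<lambda>(_::nat) _. 0) {}"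
    by (rule decidesI[of _ _ _ 0 "{}"]) simp
  moreover have "sets M = sigma_sets (space M) (range (\<lambda>_::nat. {}))"
    using M True by (auto simp: sigma_sets_empty_eq)
  ultimately show thesis using True that[of "\<lambda>_ _. 0" "\<lambda>_. {}"] by blast
next
  case False
  from assms obtain X where X: "completely_metrizable_space X" "separable_space X"
    "space M = topspace X" "sets M = sigma_sets (topspace X) {U. openin X U}"
    unfolding standard_borel_def polish_topology_def by blast
  then obtain S d where Sd: "Metric_space S d" "Metric_space.mcomplete S d"
    "X = Metric_space.mtopology S d"
    unfolding completely_metrizable_space_def by blast
  interpret Metric_space S d by fact
  have S: "topspace X = S" "space M = S" using Sd X by auto
  obtain D where D: "countable D" "D \<subseteq> S" "X closure_of D = S"
    using X(2) S unfolding separable_space_def by auto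
  have "D \<noteq> {}" using D(3) False S by auto
  define u where "u = from_nat_into D"
  have u: "range u = D" using D(1) \<open>D \<noteq> {}\<close> by (simp add: u_def)
  define \<rho> :: "nat \<Rightarrow> real" where "\<rho> k = (1/2)^k" for k
  have \<rho>: "\<And>k. \<rho> k > 0" "decseq \<rho>" "\<And>e. e > 0 \<Longrightarrow> \<exists>n. \<rho> n < e"
    unfolding \<rho>_def decseq_def
    by (auto intro: power_decreasing real_arch_pow_inv)
  have balls: "mball x r \<in> sets M" for x r
    unfolding X(4) using Sd(3) by (intro sigma_sets.Basic) auto
  have "range u \<subseteq> S" "mtopology closure_of range u = S" using u D Sd(3) by auto
  from mball_coding[OF Sd(2) this S(2) balls \<rho>]
  obtain c :: "nat + nat \<times> nat \<Rightarrow> 'a \<Rightarrow> nat" where c: "complete_coding M c"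
    and dec: "\<And>i k. decides M c (mball (u i) (\<rho> k))" by blast
  define C where "C j = (case prod_decode j of (i, k) \<Rightarrow> mball (u i) (\<rho> k))" for j
  have C: "mball (u i) (\<rho> k) \<in> range C" for i k
    by (rule range_eqI[of _ _ "prod_encode (i, k)"]) (simp add: C_def)
  have small: "\<exists>j. x \<in> C j \<and> C j \<subseteq> mball x r" if x: "x \<in> S" and r: "r > 0" for x r
  proof -
    obtain k where k: "\<rho> k < r / 2" using \<rho>(3)[of "r/2"] r by auto
    have "x \<in> mtopology closure_of (range u)" using D(3) Sd(3) u x by simp
    then obtain i where i: "d x (u i) < \<rho> k"
      unfolding metric_closure_of using \<rho>(1)[of k] by fastforce
    have uS: "u i \<in> S" using u D by auto
    have "mball (u i) (\<rho> k) \<subseteq> mball x r"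
    proof
      fix y assume "y \<in> mball (u i) (\<rho> k)"
      then have y: "y \<in> S" "d (u i) y < \<rho> k" by auto
      have "d x y \<le> d x (u i) + d (u i) y" using x y uS by (intro triangle)
      then show "y \<in> mball x r" using x y i k by simp
    qed
    moreover have "x \<in> mball (u i) (\<rho> k)" using x uS i by (simp add: commute)
    ultimately show ?thesis using C[of i k] by (metis (full_types) imageE)
  qed
  show thesis
  proof (rule that[of "\<lambda>n. c (from_nat n)" C])
    show "complete_coding M (\<lambda>n. c (from_nat n))" by (rule complete_coding_reindex[OF c])
    show dec': "decides M (\<lambda>n. c (from_nat n)) (C j)" for j
      unfolding C_def using dec by (auto split: prod.split intro: decides_reindex)
    show "x = y" if "x \<in> space M" "y \<in> space M" and eq: "\<And>j. x \<in> C j \<longleftrightarrow> y \<in> C j" for x y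
    proof (rule ccontr)
      assume "x \<noteq> y"
      have xy: "x \<in> S" "y \<in> S" using that(1,2) S(2) by simp_all
      with \<open>x \<noteq> y\<close> have "d x y > 0" by simp
      then obtain j where "x \<in> C j" "C j \<subseteq> mball x (d x y)" 
        using small[OF xy(1)] by blast
      then show False using eq[of j] by auto
    qed
    show "sets M = sigma_sets (space M) (range C)"
    proof
      have "C j \<in> sets M" for j
        by (rule decides_sets[OF \<open>complete_coding M (\<lambda>n. c (from_nat n))\<close> dec'])
      then show "sigma_sets (space M) (range C) \<subseteq> sets M"
        by (intro sets.sigma_sets_subset) auto
      have "U \<in> sigma_sets (space M) (range C)" if "openin X U" for U
      proof -
        have "U = (\<Union>j. if C j \<subseteq> U then C j else {})"
        proof -
          have "\<exists>j. x \<in> C j \<and> C j \<subseteq> U" if "x \<in> U" for x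
          proof -
            obtain r where "r > 0" "mball x r \<subseteq> U"
              using \<open>openin X U\<close> \<open>x \<in> U\<close> unfolding Sd(3) openin_mtopology by blast
            moreover have "x \<in> S" using \<open>openin X U\<close> \<open>x \<in> U\<close> S openin_subset by blast
            ultimately show ?thesis using small[of x r] by blast
          qed
          then show ?thesis by (auto split: if_splits)
        qed
        moreover have "(\<Union>j. if C j \<subseteq> U then C j else {}) \<in> sigma_sets (space M) (range C)"
          by (rule sigma_sets.Union) (auto intro: sigma_sets.Basic sigma_sets.Empty)
        ultimately show ?thesis by simp
      qed
      then have "{U. openin X U} \<subseteq> sigma_sets (space M) (range C)" by blast
      then show "sets M \<subseteq> sigma_sets (space M) (range C)"
        unfolding X(4) X(3)[symmetric] by (rule sigma_sets_mono)
    qed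
  qed
qed

text \<open>The join of countably many Polish topologies: the limits \<open>x n\<close> found by the
  single codings could differ, but the sets \<open>C j\<close>, decided by every coding, generate a
  common Hausdorff topology, in which the diagonal is closed.\<close>

lemma complete_coding_Pair:
  fixes c :: "nat \<Rightarrow> nat \<Rightarrow> 'a \<Rightarrow> nat"
  assumes c: "\<And>n. complete_coding M (c n)" and dec: "\<And>n j. decides M (c n) (C j)"
    and sep: "\<And>x y. x \<in> space M \<Longrightarrow> y \<in> space M \<Longrightarrow> (\<And>j::nat. x \<in> C j \<longleftrightarrow> y \<in> C j) \<Longrightarrow> x = y"
  shows "complete_coding M (\<lambda>(n, i). c n i)"
proof (rule complete_codingI)
  show "(case p of (n, i) \<Rightarrow> c n i) \<in> measurable M (count_space UNIV)" for p
    using c by (auto split: prod.split intro: complete_coding_measurable)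
next
  fix \<alpha> :: "nat \<times> nat \<Rightarrow> nat"
  assume fin: "\<And>F. finite F \<Longrightarrow> \<exists>x\<in>space M. \<forall>p\<in>F. (case p of (n, i) \<Rightarrow> c n i) x = \<alpha> p"
  have "\<exists>x\<in>space M. \<forall>i. c n i x = \<alpha> (n, i)" for n
  proof (rule complete_codingD[OF c])
    fix F :: "nat set" assume "finite F"
    then show "\<exists>x\<in>space M. \<forall>i\<in>F. c n i x = \<alpha> (n, i)"
      using fin[of "Pair n ` F"] by auto
  qed
  then obtain x where x: "\<And>n. x n \<in> space M" "\<And>n i. c n i (x n) = \<alpha> (n, i)" by metis
  have "x n = x 0" for n
  proof (rule sep[OF x(1) x(1)])
    fix j
    obtain i where i: "\<And>x y. x \<in> space M \<Longrightarrow> y \<in> space M \<Longrightarrow> c n i x = c n i y \<Longrightarrow> x \<in> C j \<longleftrightarrow> y \<in> C j"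
      by (rule decidesE[OF dec[of n j]]) blast
    obtain i' where i': "\<And>x y. x \<in> space M \<Longrightarrow> y \<in> space M \<Longrightarrow> c 0 i' x = c 0 i' y \<Longrightarrow> x \<in> C j \<longleftrightarrow> y \<in> C j"
      by (rule decidesE[OF dec[of 0 j]]) blast
    obtain y where "y \<in> space M" "c n i y = \<alpha> (n, i)" "c 0 i' y = \<alpha> (0, i')"
      using fin[of "{(n, i), (0, i')}"] by auto
    then show "x n \<in> C j \<longleftrightarrow> x 0 \<in> C j"
      using i[of "x n" y] i'[of "x 0" y] x by simp
  qed
  then have "c n i (x 0) = \<alpha> (n, i)" for n i using x(2) by metis
  then show "\<exists>x\<in>space M. \<forall>p. (case p of (n, i) \<Rightarrow> c n i) x = \<alpha> p"
    using x(1)[of 0] by auto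
qed

lemma decides_Pair:
  "decides M (c n) Q \<Longrightarrow> decides M (\<lambda>(n, i). c n i) Q"
proof -
  assume "decides M (c n) Q"
  then obtain i S where "Q = {x \<in> space M. c n i x \<in> S}" by (auto simp: decides_def)
  then show ?thesis by (intro decidesI[of _ _ _ "(n, i)" S]) auto
qed

text \<open>
  The union is decided by a new coordinate recording the first set of the family that contains
  the point; since the sets themselves are decided, no limit point is lost.
\<close>

lemma complete_coding_UN:
  fixes c :: "'i \<Rightarrow> 'a \<Rightarrow> nat" and Q :: "nat \<Rightarrow> 'a set"
  assumes c: "complete_coding M c" and dec: "\<And>n. decides M c (Q n)"
  shows "\<exists>c' :: 'i option \<Rightarrow> 'a \<Rightarrow> nat. complete_coding M c' \<and> decides M c' (\<Union>n. Q n) \<and>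
           (\<forall>P. decides M c P \<longrightarrow> decides M c' P)"
proof -
  have [measurable]: "Q n \<in> sets M" for n by (rule decides_sets[OF c dec])
  define m where "m x = (if x \<in> (\<Union>n. Q n) then Suc (LEAST n. x \<in> Q n) else 0)" for x
  define c' where "c' = case_option m c"
  have [measurable]: "m \<in> measurable M (count_space UNIV)" unfolding m_def by measurable
  have Qs: "Q n \<subseteq> space M" for n by (rule decidesE[OF dec])
  have "complete_coding M c'"
  proof (rule complete_codingI)
    show "c' i \<in> measurable M (count_space UNIV)" for i
      by (cases i) (auto simp: c'_def intro: complete_coding_measurable[OF c])
  next
    fix \<alpha> :: "'i option \<Rightarrow> nat"
    assume fin: "\<And>F. finite F \<Longrightarrow> \<exists>x\<in>space M. \<forall>i\<in>F. c' i x = \<alpha> i"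
    have "\<exists>x\<in>space M. \<forall>i. c i x = \<alpha> (Some i)"
    proof (rule complete_codingD[OF c])
      fix F :: "'i set" assume "finite F"
      then show "\<exists>x\<in>space M. \<forall>i\<in>F. c i x = \<alpha> (Some i)"
        using fin[of "Some ` F"] by (auto simp: c'_def)
    qed
    then obtain x where x: "x \<in> space M" "\<And>i. c i x = \<alpha> (Some i)" by blast
    have "\<exists>i. \<forall>x\<in>space M. \<forall>y\<in>space M. c i x = c i y \<longrightarrow> (x \<in> Q n \<longleftrightarrow> y \<in> Q n)" for n
      by (rule decidesE[OF dec[of n]]) blast
    then obtain i where i: "\<And>n x y. x \<in> space M \<Longrightarrow> y \<in> space M \<Longrightarrow> c (i n) x = c (i n) y \<Longrightarrow>
        x \<in> Q n \<longleftrightarrow> y \<in> Q n" by metis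
    have approx: "\<exists>y. m y = \<alpha> None \<and> (\<forall>n\<le>k. x \<in> Q n \<longleftrightarrow> y \<in> Q n)" for k
    proof -
      obtain y where y: "y \<in> space M" "\<forall>j \<in> insert None ((Some \<circ> i) ` {..k}). c' j y = \<alpha> j"
        using fin[of "insert None ((Some \<circ> i) ` {..k})"] by auto
      then have "m y = \<alpha> None" "\<And>n. n \<le> k \<Longrightarrow> c (i n) y = c (i n) x"
        using x by (auto simp: c'_def)
      then show ?thesis using i[OF x(1) y(1)] by (intro exI[of _ y]) auto
    qed
    have "m x = \<alpha> None"
    proof (cases "x \<in> (\<Union>n. Q n)")
      case True
      define l where "l = (LEAST n. x \<in> Q n)"
      have l: "x \<in> Q l" using True unfolding l_def by (auto intro: LeastI)
      obtain y where y: "m y = \<alpha> None" "\<And>n. n \<le> l \<Longrightarrow> x \<in> Q n \<longleftrightarrow> y \<in> Q n"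
        using approx[of l] by blast
      have "(LEAST n. y \<in> Q n) = l"
      proof (rule Least_equality)
        show "y \<in> Q l" using y l by simp
        show "l \<le> n" if "y \<in> Q n" for n
        proof (rule ccontr)
          assume "\<not> l \<le> n"
          then have "x \<in> Q n" using y(2)[of n] that by simp
          then have "l \<le> n" unfolding l_def by (rule Least_le)
          then show False using \<open>\<not> l \<le> n\<close> by simp
        qed
      qed
      moreover have "y \<in> Q l" using y l by simp
      ultimately have "m y = Suc l" unfolding m_def by auto
      then show ?thesis using y(1) True by (simp add: m_def l_def)
    next
      case False
      show ?thesis
      proof (cases "\<alpha> None")
        case 0
        then show ?thesis using False by (simp add: m_def)
      next
        \<comment> \<open>This value is impossible: an approximant would lie in \<open>Q l\<close>,
          and there it agrees with \<open>x\<close>.\<close>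
        case (Suc l)
        obtain y where y: "m y = Suc l" "\<And>n. n \<le> l \<Longrightarrow> x \<in> Q n \<longleftrightarrow> y \<in> Q n"
          using approx[of l] Suc by auto
        then have "y \<in> (\<Union>n. Q n)" "l = (LEAST n. y \<in> Q n)"
          by (auto simp: m_def split: if_splits)
        then have "y \<in> Q l" using LeastI_ex[of "\<lambda>n. y \<in> Q n"] by auto
        then show ?thesis using y False by auto
      qed
    qed
    then have "c' j x = \<alpha> j" for j using x by (cases j) (auto simp: c'_def)
    then show "\<exists>x\<in>space M. \<forall>j. c' j x = \<alpha> j" using x by blast
  qed
  moreover have "decides M c' (\<Union>n. Q n)"
    using Qs by (intro decidesI[of _ _ _ None "- {0}"]) (auto simp: c'_def m_def)
  moreover have "decides M c' P" if "decides M c P" for P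
  proof -
    from that obtain i S where "P = {x \<in> space M. c i x \<in> S}" by (auto simp: decides_def)
    then show ?thesis by (intro decidesI[of _ _ _ "Some i" S]) (auto simp: c'_def)
  qed
  ultimately show ?thesis by blast
qed

text \<open>The counterpart of refining a Polish topology so that countably many Borel sets become
  clopen.\<close>

theorem standard_borel_coding:
  fixes Q :: "nat \<Rightarrow> 'a set"
  assumes M: "standard_borel M" and Q: "\<And>j. Q j \<in> sets M"
  obtains c :: "nat \<Rightarrow> 'a \<Rightarrow> nat" where "complete_coding M c" and "\<And>j. decides M c (Q j)"
proof -
  obtain C :: "nat \<Rightarrow> 'a set" and c0 :: "nat \<Rightarrow> 'a \<Rightarrow> nat"
    where c0: "complete_coding M c0" "\<And>j. decides M c0 (C j)"
    and sep: "\<And>x y. x \<in> space M \<Longrightarrow> y \<in> space M \<Longrightarrow> (\<And>j. x \<in> C j \<longleftrightarrow> y \<in> C j) \<Longrightarrow> x = y"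
    and gen: "sets M = sigma_sets (space M) (range C)"
    by (rule standard_borel_base[OF M]) blast
  \<comment> \<open>Keeping every \<open>C j\<close> decided throughout the induction is what allows
    countably many codings to be joined.\<close>
  define good where "good c \<longleftrightarrow> complete_coding M c \<and> (\<forall>j. decides M c (C j))"
    for c :: "nat \<Rightarrow> 'a \<Rightarrow> nat"
  have combine: "\<exists>c. good c \<and> (\<forall>j. decides M c (P j))"
    if "\<And>j::nat. \<exists>c. good c \<and> decides M c (P j)" for P
  proof -
    from that obtain c where c: "\<And>j. good (c j)" "\<And>j. decides M (c j) (P j)" by metis
    have "complete_coding M (\<lambda>(n, i). c n i)"
      using c(1) sep unfolding good_def by (intro complete_coding_Pair[of M c C]) auto
    moreover have "decides M (\<lambda>(n, i). c n i) (C j)" for j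
      using c(1) decides_Pair[of M c 0] by (auto simp: good_def)
    moreover have "decides M (\<lambda>(n, i). c n i) (P j)" for j
      using c(2) by (rule decides_Pair)
    ultimately show ?thesis
      unfolding good_def
      by (intro exI[of _ "\<lambda>n. (\<lambda>(n, i). c n i) (from_nat n)"])
         (auto intro!: decides_reindex complete_coding_reindex)
  qed
  have "\<exists>c. good c \<and> decides M c P" if "P \<in> sets M" for P
    using that unfolding gen
  proof induction
    case (Basic P)
    then show ?case using c0 by (auto simp: good_def)
  next
    case Empty
    have "decides M c0 {}" by (rule decidesI[of _ _ _ 0 "{}"]) simp
    then show ?case using c0 by (auto simp: good_def)
  next
    case (Compl P)
    then show ?case by (auto intro: decides_Compl)
  next
    case (Union P)
    then obtain c where c: "good c" "\<And>j. decides M c (P j)" using combine[of P] by blast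
    obtain c' :: "nat option \<Rightarrow> 'a \<Rightarrow> nat" where c': "complete_coding M c'"
      "decides M c' (\<Union>n. P n)" "\<And>P. decides M c P \<Longrightarrow> decides M c' P"
      using complete_coding_UN[of M c P] c unfolding good_def by blast
    then show ?case
      using c(1) unfolding good_def
      by (intro exI[of _ "\<lambda>n. c' (from_nat n)"])
         (auto intro!: decides_reindex complete_coding_reindex)
  qed
  then show thesis using combine[of Q] Q that unfolding good_def by blast
qed

section \<open>Images under finite-to-one Borel maps\<close>

text \<open>The last two assumptions make \<open>f\<close> continuous into a Hausdorff topology, the
  one generated by the \<open>U j\<close> and their complements.\<close>

locale coded_map =
  fixes M :: "'a measure" and N :: "'b measure" and f :: "'a \<Rightarrow> 'b"
    and c :: "nat \<Rightarrow> 'a \<Rightarrow> nat" and U :: "nat \<Rightarrow> 'b set"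
  assumes coding: "complete_coding M c"
    and f: "f \<in> measurable M N"
    and U: "\<And>j. U j \<in> sets N"
    and separating: "\<And>x y. x \<in> space N \<Longrightarrow> y \<in> space N \<Longrightarrow> (\<And>j. x \<in> U j \<longleftrightarrow> y \<in> U j) \<Longrightarrow> x = y"
    and decided: "\<And>j. decides M c (f -` U j \<inter> space M)"
begin

definition borel_separated :: "(nat \<Rightarrow> 'a set) \<Rightarrow> bool" where
  "borel_separated Y \<longleftrightarrow>
     (\<exists>B. (\<forall>m. B m \<in> sets N \<and> f ` Y m \<subseteq> B m) \<and> (\<Inter>m. B m) = {})"

lemma borel_separatedI:
  assumes "\<And>m. B m \<in> sets N" and "\<And>m. f ` Y m \<subseteq> B m" and "(\<Inter>m. B m) = {}"
  shows "borel_separated Y"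
  using assms unfolding borel_separated_def by blast

lemma borel_separated_empty:
  assumes "Y a = {}" and "\<And>m. Y m \<subseteq> space M"
  shows "borel_separated Y"
proof (rule borel_separatedI[of "\<lambda>m. if m = a then {} else space N"])
  show "f ` Y m \<subseteq> (if m = a then {} else space N)" for m
    using assms measurable_space[OF f] by auto
qed (auto split: if_splits)

text \<open>At \<open>a\<close> the hulls of the pieces are united, at all other indices they are
  intersected; a point common to all the new hulls would be common to the hulls for one
  piece.\<close>

lemma borel_separated_split:
  assumes Z: "\<And>k::nat. borel_separated (Y(a := Z k))" and Ya: "Y a \<subseteq> (\<Union>k. Z k)"
  shows "borel_separated Y"
proof -
  from Z obtain B where B: "\<And>k m. B k m \<in> sets N" "\<And>k m. f ` (Y(a := Z k)) m \<subseteq> B k m"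
    "\<And>k. (\<Inter>m. B k m) = {}" unfolding borel_separated_def by metis
  define D where "D m = (if m = a then (\<Union>k. B k a) else (\<Inter>k. B k m))" for m
  show ?thesis
  proof (rule borel_separatedI[of D])
    show "D m \<in> sets N" for m using B(1) by (auto simp: D_def)
    show "f ` Y m \<subseteq> D m" for m
    proof (cases "m = a")
      case True
      have "f ` Z k \<subseteq> B k a" for k using B(2)[where k = k and m = a] by simp
      then show ?thesis using True Ya by (auto simp: D_def) blast
    next
      case False
      have "f ` Y m \<subseteq> B k m" for k using B(2)[where k = k and m = m] False by simp
      then show ?thesis using False by (auto simp: D_def)
    qed
    show "(\<Inter>m. D m) = {}"
    proof (rule ccontr)
      assume "(\<Inter>m. D m) \<noteq> {}"
      then obtain v where v: "\<And>m. v \<in> D m" by auto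
      from v[of a] obtain k where "v \<in> B k a" by (auto simp: D_def)
      then have "v \<in> B k m" for m using v[of m] by (cases "m = a") (auto simp: D_def)
      then show False using B(3)[of k] by blast
    qed
  qed
qed

text \<open>
  Novikov's separation theorem. If separation fails, it still fails after one of the sets is cut
  down to a suitable value of one coordinate. Doing this for all sets and all coordinates leaves one
  point in each set; two of these points have different images, and these are separated by
  some \<open>U j\<close> already at a finite stage.
\<close>

theorem novikov_separation:
  fixes X :: "nat \<Rightarrow> 'a set"
  assumes X: "\<And>m. decides M c (X m)" and disj: "(\<Inter>m. f ` X m) = {}"
  shows "borel_separated X"
proof (rule ccontr)
  assume not_sep: "\<not> borel_separated X"
  define P where "P t Y \<longleftrightarrow> \<not> borel_separated Y \<and> (t = (0::nat) \<longrightarrow> Y = X)" for t Y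
  \<comment> \<open>\<open>prod_decode\<close> runs through all pairs of a set and a coordinate, so
    every coordinate of every set is eventually fixed.\<close>
  define cut where "cut t k Y = (case prod_decode t of (m, i) \<Rightarrow> Y(m := Y m \<inter> {x. c i x = k}))"
    for t :: nat and k :: nat and Y :: "nat \<Rightarrow> 'a set"
  have ex0: "\<exists>Y. P 0 Y" using not_sep by (auto simp: P_def)
  have exS: "\<exists>Y'. P (Suc t) Y' \<and> (\<exists>k. Y' = cut t k Y)" if "P t Y" for Y t
  proof -
    obtain m i where mi: "prod_decode t = (m, i)" by force
    have "\<exists>k. \<not> borel_separated (cut t k Y)"
    proof (rule ccontr)
      assume "\<nexists>k. \<not> borel_separated (cut t k Y)"
      then have "borel_separated (Y(m := Y m \<inter> {x. c i x = k}))" for k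
        by (simp add: cut_def mi)
      then have "borel_separated Y" by (rule borel_separated_split) auto
      then show False using that by (simp add: P_def)
    qed
    then show ?thesis by (auto simp: P_def)
  qed
  obtain Y where Y: "\<And>t. P t (Y t) \<and> (\<exists>k. Y (Suc t) = cut t k (Y t))"
    using dependent_nat_choice[of P "\<lambda>t Y Y'. \<exists>k. Y' = cut t k Y"] ex0 exS by blast
  have Y0: "Y 0 = X" and nsep: "\<And>t. \<not> borel_separated (Y t)" using Y by (auto simp: P_def)
  from Y obtain k where k: "\<And>t. Y (Suc t) = cut t (k t) (Y t)" by metis
  define \<alpha> where "\<alpha> m i = k (prod_encode (m, i))" for m i
  have anti: "Y t' m \<subseteq> Y t m" if "t \<le> t'" for t t' m
    using that
  proof (induction rule: dec_induct)
    case (step n)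
    have "Y (Suc n) m \<subseteq> Y n m" by (auto simp: k cut_def split: prod.splits if_splits)
    then show ?case using step by blast
  qed simp
  have cutY: "Y t m \<subseteq> {x. c i x = \<alpha> m i}" if "prod_encode (m, i) < t" for t m i
  proof -
    have "Y (Suc (prod_encode (m, i))) m \<subseteq> {x. c i x = \<alpha> m i}"
      by (simp add: k cut_def \<alpha>_def)
    then show ?thesis using anti[of "Suc (prod_encode (m, i))" t m] that by auto
  qed
  have Xsp: "X m \<subseteq> space M" for m by (rule decidesE[OF X]) blast
  have YX: "Y t m \<subseteq> X m" for t m using anti[of 0 t m] Y0 by simp
  have nonempty: "Y t m \<noteq> {}" for t m
    using borel_separated_empty[of "Y t" m] nsep YX Xsp by blast
  have approx: "\<exists>y\<in>X m. \<forall>i\<in>F. c i y = \<alpha> m i" if F: "finite F" for m F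
  proof -
    obtain t where t: "\<And>i. i \<in> F \<Longrightarrow> prod_encode (m, i) < t"
      using finite_nat_set_iff_bounded[of "(\<lambda>i. prod_encode (m, i)) ` F"] F by auto
    obtain y where "y \<in> Y t m" using nonempty[of t m] by blast
    then show ?thesis using cutY[OF t] YX[of t m] by (intro bexI[of _ y]) auto
  qed
  have "\<exists>x\<in>space M. \<forall>i. c i x = \<alpha> m i" for m
    using approx[of _ m] Xsp[of m] by (intro complete_codingD[OF coding]) blast
  then obtain x where x: "\<And>m. x m \<in> space M" "\<And>m i. c i (x m) = \<alpha> m i" by metis
  have xX: "x m \<in> X m" for m
  proof -
    obtain i where i: "\<And>x y. x \<in> space M \<Longrightarrow> y \<in> space M \<Longrightarrow> c i x = c i y \<Longrightarrow> x \<in> X m \<longleftrightarrow> y \<in> X m"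
      by (rule decidesE[OF X[of m]]) blast
    obtain y where "y \<in> X m" "c i y = \<alpha> m i" using approx[of "{i}" m] by auto
    then show ?thesis using i[of "x m" y] x subsetD[OF Xsp] by auto
  qed
  have "\<exists>m. f (x m) \<noteq> f (x 0)"
  proof (rule ccontr)
    assume "\<not> ?thesis"
    then have "f (x 0) \<in> f ` X m" for m using xX[of m] by (metis imageI)
    then show False using disj by blast
  qed
  then obtain m where m: "f (x m) \<noteq> f (x 0)" by blast
  have fN: "f y \<in> space N" if "y \<in> space M" for y using measurable_space[OF f that] .
  obtain j where j: "f (x m) \<in> U j \<longleftrightarrow> f (x 0) \<notin> U j"
    using separating[OF fN[OF x(1)[of m]] fN[OF x(1)[of 0]]] m by blast
  obtain i where i: "\<And>x y. x \<in> space M \<Longrightarrow> y \<in> space M \<Longrightarrow> c i x = c i y \<Longrightarrow>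
      x \<in> f -` U j \<inter> space M \<longleftrightarrow> y \<in> f -` U j \<inter> space M"
    by (rule decidesE[OF decided[of j]]) blast
  \<comment> \<open>By this stage coordinate \<open>i\<close> is fixed in the sets with indices
    \<open>m\<close> and \<open>0\<close>.\<close>
  define t where "t = Suc (max (prod_encode (m, i)) (prod_encode (0, i)))"
  define W where "W v = (if v \<in> U j then U j else space N - U j)" for v
  have Ysp: "Y t n \<subseteq> space M" for n using YX Xsp by blast
  have in_W: "f ` Y t n \<subseteq> W (f (x n))" if "n = m \<or> n = 0" for n
  proof
    fix v assume "v \<in> f ` Y t n"
    then obtain y where y: "y \<in> Y t n" "v = f y" by blast
    have "prod_encode (n, i) < t" using that by (auto simp: t_def)
    then have "c i y = c i (x n)" using cutY[of n i t] y x(2) by auto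
    then have "f y \<in> U j \<longleftrightarrow> f (x n) \<in> U j"
      using i[of y "x n"] y(1) Ysp[of n] x(1)[of n] by blast
    then show "v \<in> W (f (x n))" using fN[of y] y Ysp[of n] by (auto simp: W_def)
  qed
  have "borel_separated (Y t)"
  proof (rule borel_separatedI[of "\<lambda>n. if n = m \<or> n = 0 then W (f (x n)) else space N"])
    show "(if n = m \<or> n = 0 then W (f (x n)) else space N) \<in> sets N" for n
      using U by (auto simp: W_def)
    show "f ` Y t n \<subseteq> (if n = m \<or> n = 0 then W (f (x n)) else space N)" for n
      using in_W[of n] fN Ysp[of n] by auto
    have "W (f (x m)) \<inter> W (f (x 0)) = {}" using j by (auto simp: W_def)
    then show "(\<Inter>n. if n = m \<or> n = 0 then W (f (x n)) else space N) = {}"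
      by (auto split: if_splits)
  qed
  then show False using nsep by blast
qed

text \<open>
  By Novikov's theorem the images of the fibres of one coordinate, a point-finite family of
  analytic sets, can be enlarged to a point-finite family of Borel sets.
\<close>

lemma point_finite_enlargement:
  assumes fin: "\<And>y. y \<in> space N \<Longrightarrow> finite {x \<in> space M. f x = y}"
  obtains D :: "nat \<Rightarrow> 'b set"
  where "\<And>n. D n \<in> sets N" and "\<And>x. x \<in> space M \<Longrightarrow> f x \<in> D (c i x)"
    and "\<And>v. finite {n. v \<in> D n}"
proof -
  \<comment> \<open>Tails rather than fibres: over one point \<open>v\<close> the coordinate takes
    finitely many values, hence is bounded, so the images of the tails have no common point.\<close>
  define X where "X m = {x \<in> space M. m \<le> c i x}" for m
  have "borel_separated X"
  proof (rule novikov_separation)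
    show "decides M c (X m)" for m
      by (rule decidesI[of _ _ _ i "{m..}"]) (auto simp: X_def)
    show "(\<Inter>m. f ` X m) = {}"
    proof (rule ccontr)
      assume "(\<Inter>m. f ` X m) \<noteq> {}"
      then obtain v where v: "\<And>m. v \<in> f ` X m" by auto
      have "v \<in> space N" using v[of 0] measurable_space[OF f] by (auto simp: X_def)
      then have "finite (c i ` {x \<in> space M. f x = v})" using fin by blast
      then obtain b where b: "\<And>x. x \<in> space M \<Longrightarrow> f x = v \<Longrightarrow> c i x < b"
        unfolding finite_nat_set_iff_bounded by auto
      from v[of b] obtain x where "x \<in> space M" "f x = v" "b \<le> c i x" by (auto simp: X_def)
      then show False using b[of x] by simp
    qed
  qed
  then obtain B where B: "\<And>m. B m \<in> sets N" "\<And>m. f ` X m \<subseteq> B m" "(\<Inter>m. B m) = {}"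
    unfolding borel_separated_def by blast
  show thesis
  \<comment> \<open>A point outside \<open>B m\<close> is missing from every hull with index at
    least \<open>m\<close>.\<close>
  proof (rule that[of "\<lambda>n. \<Inter>m\<in>{..n}. B m"])
    show "(\<Inter>m\<in>{..n}. B m) \<in> sets N" for n using B(1) by (intro sets.finite_INT) auto
    show "f x \<in> (\<Inter>m\<in>{..c i x}. B m)" if "x \<in> space M" for x
      using B(2) that by (auto simp: X_def)
    show "finite {n. v \<in> (\<Inter>m\<in>{..n}. B m)}" for v
    proof -
      obtain m where "v \<notin> B m" using B(3) by blast
      then have "{n. v \<in> (\<Inter>m\<in>{..n}. B m)} \<subseteq> {..<m}" by (auto simp: not_le[symmetric])
      then show ?thesis by (rule finite_subset) simp
    qed
  qed
qed

text \<open>Koenig's lemma, with branching bounded per level because a point-finite family belongs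
  to one coordinate, that is, to one level.\<close>

lemma koenig_prefixes:
  fixes T :: "nat list \<Rightarrow> bool"
  assumes prefix: "\<And>s n. T (s @ [n]) \<Longrightarrow> T s"
    and finite_branching: "\<And>k. finite {n. \<exists>s. length s = k \<and> T (s @ [n])}"
    and infinite: "\<And>k. \<exists>s. length s = k \<and> T s"
  shows "\<exists>\<alpha>. \<forall>k. T (map \<alpha> [0..<k])"
proof -
  define G where "G s \<longleftrightarrow> (\<forall>k. \<exists>r. length r = k \<and> T (s @ r))" for s
  have prefixes: "T (s @ r) \<Longrightarrow> T s" for s r
    by (induction r rule: rev_induct) (auto dest: prefix simp flip: append_assoc)
  have step: "\<exists>n. G (s @ [n])" if "G s" for s
  proof (rule ccontr)
    assume "\<nexists>n. G (s @ [n])"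
    \<comment> \<open>If every child of \<open>s\<close> has a bounded subtree, the finitely many
      possible children give a common bound, which contradicts \<open>G s\<close>.\<close>
    then obtain b where b: "\<And>n r. length r = b n \<Longrightarrow> \<not> T (s @ [n] @ r)"
      unfolding G_def by (metis append_assoc)
    let ?F = "{n. \<exists>s'. length s' = length s \<and> T (s' @ [n])}"
    have "finite (b ` ?F)" using finite_branching by blast
    then obtain k where k: "\<And>n. n \<in> ?F \<Longrightarrow> b n \<le> k" unfolding finite_nat_set_iff_bounded_le by auto
    from \<open>G s\<close> obtain r where r: "length r = Suc k" "T (s @ r)" unfolding G_def by blast
    then obtain n r' where nr: "r = n # r'" "length r' = k" by (cases r) auto
    have "T ((s @ [n]) @ r')" using r nr by simp
    then have "T (s @ [n])" by (rule prefixes)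
    then have "b n \<le> k" by (intro k) auto
    moreover have "T ((s @ [n] @ take (b n) r') @ drop (b n) r')" using r nr by simp
    then have "T (s @ [n] @ take (b n) r')" by (rule prefixes)
    ultimately show False using b[of "take (b n) r'" n] nr by simp
  qed
  have "G []" unfolding G_def using infinite by simp
  have "\<exists>S. \<forall>k. (length (S k) = k \<and> G (S k)) \<and> (\<exists>n. S (Suc k) = S k @ [n])"
  proof (rule dependent_nat_choice)
    show "\<exists>s. length s = 0 \<and> G s" using \<open>G []\<close> by simp
    show "\<exists>s'. (length s' = Suc k \<and> G s') \<and> (\<exists>n. s' = s @ [n])"
      if "length s = k \<and> G s" for s k
      using step[of s] that by force
  qed
  then obtain S where S: "\<And>k. length (S k) = k" "\<And>k. G (S k)" "\<And>k. \<exists>n. S (Suc k) = S k @ [n]"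
    by blast
  from S(3) obtain \<alpha> where \<alpha>: "\<And>k. S (Suc k) = S k @ [\<alpha> k]" by metis
  have "S k = map \<alpha> [0..<k]" for k using S(1)[of 0] by (induction k) (auto simp: \<alpha>)
  moreover have "T (S k)" for k using S(2)[of k] unfolding G_def by (metis append_Nil2 length_0_conv)
  ultimately show ?thesis by auto
qed

text \<open>
  A point \<open>v\<close> lies in the image iff the tree of all cylinders whose Borel hull contains \<open>v\<close> has an
  infinite branch; as the tree is finitely branching, this means that all its levels are inhabited,
  which is a Borel condition on \<open>v\<close>.
\<close>

theorem finite_to_one_range_measurable:
  assumes fin: "\<And>y. y \<in> space N \<Longrightarrow> finite {x \<in> space M. f x = y}"
  shows "f ` space M \<in> sets N"
proof -
  have "\<exists>D. (\<forall>n. D n \<in> sets N) \<and> (\<forall>x\<in>space M. f x \<in> D (c i x)) \<and> (\<forall>v. finite {n. v \<in> D n})" for i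
    by (rule point_finite_enlargement[OF fin]) blast+
  then obtain D where D: "\<And>i n. D i n \<in> sets N" "\<And>i x. x \<in> space M \<Longrightarrow> f x \<in> D i (c i x)"
    "\<And>i v. finite {n. v \<in> D i n}" by metis
  define Cyl where "Cyl s = {x \<in> space M. \<forall>i<length s. c i x = s ! i}" for s
  \<comment> \<open>The points that neither a \<open>U j\<close> nor its complement separates from
    the image of the cylinder. For an empty cylinder both implications apply, so its hull is
    empty.\<close>
  define H where "H s = (\<Inter>j. {v \<in> space N. (f ` Cyl s \<subseteq> U j \<longrightarrow> v \<in> U j) \<and>
    (f ` Cyl s \<inter> U j = {} \<longrightarrow> v \<notin> U j)})" for s
  define T where "T v s \<longleftrightarrow> v \<in> H s \<and> (\<forall>i<length s. v \<in> D i (s ! i))" for v s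
  have fN: "f y \<in> space N" if "y \<in> space M" for y using measurable_space[OF f that] .
  have [measurable]: "H s \<in> sets N" for s
    unfolding H_def using U by measurable
  have [measurable]: "Measurable.pred N (\<lambda>v. T v s)" for s
    unfolding T_def using D(1) by measurable
  have HCyl: "f x \<in> H s" if "x \<in> Cyl s" for x s
    using that fN by (auto simp: H_def Cyl_def)
  have "f ` space M = {v \<in> space N. \<forall>k. \<exists>s. length s = k \<and> T v s}"
  proof (intro set_eqI iffI)
    fix v assume "v \<in> f ` space M"
    then obtain x where x: "x \<in> space M" "v = f x" by blast
    have "T v (map (\<lambda>i. c i x) [0..<k])" for k
      unfolding T_def x(2) using D(2) x(1) by (auto intro!: HCyl simp: Cyl_def)
    then show "v \<in> {v \<in> space N. \<forall>k. \<exists>s. length s = k \<and> T v s}"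
      using x fN by (auto intro!: exI[of _ "map (\<lambda>i. c i x) [0..<_]"])
  next
    fix v assume "v \<in> {v \<in> space N. \<forall>k. \<exists>s. length s = k \<and> T v s}"
    then have v: "v \<in> space N" "\<And>k. \<exists>s. length s = k \<and> T v s" by auto
    have "\<exists>\<alpha>. \<forall>k. T v (map \<alpha> [0..<k])"
    proof (rule koenig_prefixes)
      fix s n assume T: "T v (s @ [n])"
      have "Cyl (s @ [n]) \<subseteq> Cyl s" by (auto simp: Cyl_def nth_append)
      then have "H (s @ [n]) \<subseteq> H s" unfolding H_def by blast
      moreover have "v \<in> D i (s ! i)" if "i < length s" for i
        using T that unfolding T_def by (metis append_eq_conv_conj length_append less_imp_le
            nth_append trans_less_add1)
      ultimately show "T v s" using T unfolding T_def by blast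
    next
      fix k
      have "{n. \<exists>s. length s = k \<and> T v (s @ [n])} \<subseteq> {n. v \<in> D k n}"
        unfolding T_def by (auto simp: nth_append)
      then show "finite {n. \<exists>s. length s = k \<and> T v (s @ [n])}"
        using D(3) by (rule finite_subset)
    qed (use v in blast)
    then obtain \<alpha> where \<alpha>: "\<And>k. T v (map \<alpha> [0..<k])" by blast
    have Cyl_ne: "Cyl (map \<alpha> [0..<k]) \<noteq> {}" for k
    proof
      assume "Cyl (map \<alpha> [0..<k]) = {}"
      then have "H (map \<alpha> [0..<k]) = {}" unfolding H_def by auto
      then show False using \<alpha>[of k] by (simp add: T_def)
    qed
    have "\<exists>x\<in>space M. \<forall>i. c i x = \<alpha> i"
    proof (rule complete_codingD[OF coding])
      fix F :: "nat set" assume "finite F"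
      then obtain k where k: "\<And>i. i \<in> F \<Longrightarrow> i < k" unfolding finite_nat_set_iff_bounded by blast
      obtain y where "y \<in> Cyl (map \<alpha> [0..<k])" using Cyl_ne[of k] by blast
      then show "\<exists>x\<in>space M. \<forall>i\<in>F. c i x = \<alpha> i" using k by (auto simp: Cyl_def)
    qed
    then obtain x where x: "x \<in> space M" "\<And>i. c i x = \<alpha> i" by blast
    have "v = f x"
    proof (rule separating[OF v(1) fN[OF x(1)]])
      fix j
      obtain i where i: "\<And>x y. x \<in> space M \<Longrightarrow> y \<in> space M \<Longrightarrow> c i x = c i y \<Longrightarrow>
          x \<in> f -` U j \<inter> space M \<longleftrightarrow> y \<in> f -` U j \<inter> space M"
        by (rule decidesE[OF decided[of j]]) blast
      have eq: "f y \<in> U j \<longleftrightarrow> f x \<in> U j" if "y \<in> Cyl (map \<alpha> [0..<Suc i])" for y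
      proof -
        have "y \<in> space M" "c i y = c i x"
          using that x(2)[of i] by (auto simp: Cyl_def simp del: upt_Suc)
        then show ?thesis using i[of y x] x(1) by blast
      qed
      have "v \<in> H (map \<alpha> [0..<Suc i])" using \<alpha>[of "Suc i"] unfolding T_def by blast
      then have H: "f ` Cyl (map \<alpha> [0..<Suc i]) \<subseteq> U j \<Longrightarrow> v \<in> U j"
        "f ` Cyl (map \<alpha> [0..<Suc i]) \<inter> U j = {} \<Longrightarrow> v \<notin> U j"
        unfolding H_def by blast+
      show "v \<in> U j \<longleftrightarrow> f x \<in> U j"
      proof (cases "f x \<in> U j")
        case True
        then show ?thesis using H(1) eq by blast
      next
        case False
        then show ?thesis using H(2) eq by blast
      qed
    qed
    then show "v \<in> f ` space M" using x(1) by blast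
  qed
  also have "\<dots> \<in> sets N" by measurable
  finally show ?thesis .
qed

end

text \<open>A case of the Lusin--Novikov theorem. It reduces to the range of a restriction: once the
  coding decides \<open>Q\<close> as well, \<open>Q\<close> is closed for it and inherits
  completeness.\<close>

theorem finite_to_one_image_measurable:
  assumes M: "standard_borel M" and N: "standard_borel N" and f: "f \<in> measurable M N"
    and fin: "\<And>y. y \<in> space N \<Longrightarrow> finite {x \<in> space M. f x = y}" and Q: "Q \<in> sets M"
  shows "f ` Q \<in> sets N"
proof -
  obtain U :: "nat \<Rightarrow> 'b set" and c0 :: "nat \<Rightarrow> 'b \<Rightarrow> nat"
    where c0: "complete_coding N c0" "\<And>j. decides N c0 (U j)"
    and sep: "\<And>x y. x \<in> space N \<Longrightarrow> y \<in> space N \<Longrightarrow> (\<And>j. x \<in> U j \<longleftrightarrow> y \<in> U j) \<Longrightarrow> x = y"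
    by (rule standard_borel_base[OF N]) blast
  have U: "U j \<in> sets N" for j using decides_sets[OF c0(1) c0(2)] .
  define W where "W = case_nat Q (\<lambda>j. f -` U j \<inter> space M)"
  have "W j \<in> sets M" for j
    using Q measurable_sets[OF f U] by (cases j) (auto simp: W_def)
  then obtain c :: "nat \<Rightarrow> 'a \<Rightarrow> nat" where c: "complete_coding M c" and W: "\<And>j. decides M c (W j)"
    by (rule standard_borel_coding[OF M, of W]) blast
  have decQ: "decides M c Q" using W[of 0] by (simp add: W_def)
  have decU: "decides M c (f -` U j \<inter> space M)" for j using W[of "Suc j"] by (simp add: W_def)
  have sp: "space (restrict_space M Q) = Q"
    using Q sets.sets_into_space by (auto simp: space_restrict_space)
  interpret coded_map "restrict_space M Q" N f c U
  proof
    show "complete_coding (restrict_space M Q) c"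
    proof (rule complete_codingI)
      show "c i \<in> measurable (restrict_space M Q) (count_space UNIV)" for i
        using complete_coding_measurable[OF c] by (rule measurable_restrict_space1)
      fix \<alpha> :: "nat \<Rightarrow> nat"
      assume "\<And>F. finite F \<Longrightarrow> \<exists>x\<in>space (restrict_space M Q). \<forall>i\<in>F. c i x = \<alpha> i"
      then have fin: "\<And>F. finite F \<Longrightarrow> \<exists>x\<in>Q. \<forall>i\<in>F. c i x = \<alpha> i" unfolding sp .
      obtain i where i: "Q \<subseteq> space M"
        "\<And>x y. x \<in> space M \<Longrightarrow> y \<in> space M \<Longrightarrow> c i x = c i y \<Longrightarrow> x \<in> Q \<longleftrightarrow> y \<in> Q"
        by (rule decidesE[OF decQ]) blast
      have "\<exists>x\<in>space M. \<forall>i. c i x = \<alpha> i"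
        using fin i(1) by (intro complete_codingD[OF c]) blast
      then obtain x where x: "x \<in> space M" "\<And>i. c i x = \<alpha> i" by blast
      obtain y where "y \<in> Q" "c i y = \<alpha> i" using fin[of "{i}"] by auto
      then have "x \<in> Q" using i(2)[of x y] x i(1) by auto
      then show "\<exists>x\<in>space (restrict_space M Q). \<forall>i. c i x = \<alpha> i" using x sp by blast
    qed
    show "f \<in> measurable (restrict_space M Q) N" using f by (rule measurable_restrict_space1)
    show "decides (restrict_space M Q) c (f -` U j \<inter> space (restrict_space M Q))" for j
    proof -
      from decU[of j] obtain i S where S: "f -` U j \<inter> space M = {x \<in> space M. c i x \<in> S}"
        by (auto simp: decides_def)
      have "f -` U j \<inter> Q = {x \<in> Q. c i x \<in> S}"
        using S Q sets.sets_into_space by blast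
      then show ?thesis unfolding sp by (intro decidesI[of _ _ _ i S]) (simp add: sp)
    qed
  qed (use U sep in auto)
  have "f ` space (restrict_space M Q) \<in> sets N"
  proof (rule finite_to_one_range_measurable)
    show "finite {x \<in> space (restrict_space M Q). f x = y}" if "y \<in> space N" for y
      using fin[OF that] by (rule rev_finite_subset) (use Q sets.sets_into_space in \<open>auto simp: sp\<close>)
  qed
  then show ?thesis unfolding sp .
qed

section \<open>Augmenting along coloured walks\<close>

text \<open>Vertices carry no Borel structure here. Conditions on them are expressed by sets of
  edges, and saturations provide the passage from one edge to the edges sharing an endpoint.\<close>

locale borel_bigraph =
  fixes E :: "'e measure" and s t :: "'e \<Rightarrow> 'v"
  assumes saturation_s: "\<And>Q. Q \<in> sets E \<Longrightarrow> {e \<in> space E. s e \<in> s ` Q} \<in> sets E"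
    and saturation_t: "\<And>Q. Q \<in> sets E \<Longrightarrow> {e \<in> space E. t e \<in> t ` Q} \<in> sets E"
    and finite_s: "\<And>e. e \<in> space E \<Longrightarrow> finite {e' \<in> space E. s e' = s e}"
    and finite_t: "\<And>e. e \<in> space E \<Longrightarrow> finite {e' \<in> space E. t e' = t e}"
begin

lemma pred_s [measurable]: "Q \<in> sets E \<Longrightarrow> Measurable.pred E (\<lambda>e. s e \<in> s ` Q)"
  using saturation_s by (simp add: pred_def)

lemma pred_t [measurable]: "Q \<in> sets E \<Longrightarrow> Measurable.pred E (\<lambda>e. t e \<in> t ` Q)"
  using saturation_t by (simp add: pred_def)

text \<open>
  The Kechris--Solecki--Todorcevic argument: every edge is separated from its finitely many
  neighbours by one of the countably many sets \<open>Q l\<close>.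
\<close>

lemma ex_edge_colouring:
  fixes C :: "nat \<Rightarrow> 'e set"
  assumes C [measurable]: "\<And>j. C j \<in> sets E"
    and sep: "\<And>x y. x \<in> space E \<Longrightarrow> y \<in> space E \<Longrightarrow> (\<And>j. x \<in> C j \<longleftrightarrow> y \<in> C j) \<Longrightarrow> x = y"
  obtains col :: "'e \<Rightarrow> nat" where "col \<in> measurable E (count_space UNIV)"
    and "\<And>e e'. e \<in> space E \<Longrightarrow> e' \<in> space E \<Longrightarrow> col e = col e' \<Longrightarrow> s e = s e' \<Longrightarrow> e = e'"
    and "\<And>e e'. e \<in> space E \<Longrightarrow> e' \<in> space E \<Longrightarrow> col e = col e' \<Longrightarrow> t e = t e' \<Longrightarrow> e = e'"
proof -
  define Q where "Q l = {x \<in> space E. \<forall>(j, b)\<in>set l. (x \<in> C j) = b}" for l :: "(nat \<times> bool) list"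
  define G where "G l = {e \<in> Q l. \<forall>e'\<in>Q l. s e' = s e \<or> t e' = t e \<longrightarrow> e' = e}" for l
  have [measurable]: "Q l \<in> sets E" for l
    unfolding Q_def by (induction l) (auto simp: pred_def[symmetric])
  have Q_Cons: "Q ((j, b) # l) = {x \<in> Q l. (x \<in> C j) = b}" for j b l by (auto simp: Q_def)
  \<comment> \<open>A different neighbour of \<open>e\<close> in \<open>Q l\<close> is separated
    from it by some \<open>C j\<close>, so failing to be isolated is a countable union, over
    \<open>j\<close> and the side \<open>b\<close> of \<open>e\<close>, of conditions on
    saturations.\<close>
  have "G l = Q l - (\<Union>(j, b). {e \<in> Q ((j, b) # l). s e \<in> s ` Q ((j, \<not> b) # l) \<or> t e \<in> t ` Q ((j, \<not> b) # l)})"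
    (is "_ = _ - ?bad") for l
  proof (intro set_eqI iffI)
    fix e assume "e \<in> G l"
    then show "e \<in> Q l - ?bad" unfolding G_def Q_Cons by fastforce
  next
    fix e assume e: "e \<in> Q l - ?bad"
    have "e' = e" if "e' \<in> Q l" "s e' = s e \<or> t e' = t e" for e'
    proof (rule sep)
      show "e' \<in> C j \<longleftrightarrow> e \<in> C j" for j
      proof (rule ccontr)
        assume "(e' \<in> C j) \<noteq> (e \<in> C j)"
        then have "e' \<in> Q ((j, \<not> (e \<in> C j)) # l)" "e \<in> Q ((j, e \<in> C j) # l)"
          using that e by (auto simp: Q_Cons)
        then have "e \<in> ?bad" using that(2) by (auto intro!: exI[of _ j] exI[of _ "e \<in> C j"] image_eqI[of _ _ e'])
        then show False using e by blast
      qed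
    qed (use that e in \<open>auto simp: Q_def\<close>)
    then show "e \<in> G l" using e by (auto simp: G_def)
  qed
  moreover have "(\<Union>(j, b). {e \<in> Q ((j, b) # l). s e \<in> s ` Q ((j, \<not> b) # l) \<or> t e \<in> t ` Q ((j, \<not> b) # l)}) \<in> sets E" for l
    by (intro sets.countable_UN') (auto split: prod.split)
  ultimately have [measurable]: "G l \<in> sets E" for l by simp
  have cover: "\<exists>l. e \<in> G l" if e: "e \<in> space E" for e
  proof -
    define B where "B = {e' \<in> space E. s e' = s e} \<union> {e' \<in> space E. t e' = t e} - {e}"
    have "finite B" using finite_s[OF e] finite_t[OF e] by (simp add: B_def)
    then obtain es where es: "set es = B" using finite_list by blast
    have "\<exists>j. (e \<in> C j) \<noteq> (e' \<in> C j)" if "e' \<in> B" for e'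
      using sep[of e e'] e that by (auto simp: B_def)
    then obtain j where j: "\<And>e'. e' \<in> B \<Longrightarrow> (e \<in> C (j e')) \<noteq> (e' \<in> C (j e'))" by metis
    define l where "l = map (\<lambda>e'. (j e', e \<in> C (j e'))) es"
    have "e' \<notin> Q l" if "e' \<in> B" for e' using that j[OF that] es by (auto simp: Q_def l_def)
    moreover have "e \<in> Q l" using e by (auto simp: Q_def l_def)
    moreover have "Q l \<subseteq> space E" by (auto simp: Q_def)
    ultimately have "e \<in> G l" unfolding G_def B_def by blast
    then show ?thesis by blast
  qed
  define col where "col e = (LEAST n. e \<in> G (from_nat n))" for e
  have col: "e \<in> G (from_nat (col e))" if "e \<in> space E" for e
  proof -
    from cover[OF that] obtain l where "e \<in> G l" by blast
    then have "e \<in> G (from_nat (to_nat l))" by simp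
    then show ?thesis unfolding col_def by (rule LeastI)
  qed
  show thesis
  proof (rule that)
    show "col \<in> measurable E (count_space UNIV)" unfolding col_def by measurable
    fix e e' assume "e \<in> space E" "e' \<in> space E" "col e = col e'"
    then have "e \<in> G (from_nat (col e))" "e' \<in> G (from_nat (col e))" using col[of e] col[of e'] by auto
    then show "s e = s e' \<Longrightarrow> e = e'" "t e = t e' \<Longrightarrow> e = e'" unfolding G_def by auto
  qed
qed

definition matching :: "'e set \<Rightarrow> bool" where
  "matching M \<longleftrightarrow> M \<subseteq> space E \<and> inj_on s M \<and> inj_on t M"

text \<open>
  A labelling certifies that alternating walks from unmatched vertices on the \<open>s\<close>-side to unmatched
  vertices on the \<open>t\<close>-side have at least \<open>2 * k + 1\<close> edges: \<open>p\<close> and \<open>q\<close> bound from below the number of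
  matching edges that a walk must use to get to a vertex.
\<close>

definition labelling :: "nat \<Rightarrow> 'e set \<Rightarrow> ('v \<Rightarrow> nat) \<Rightarrow> ('v \<Rightarrow> nat) \<Rightarrow> bool" where
  "labelling k M p q \<longleftrightarrow>
     (\<forall>e\<in>space E. q (t e) \<le> p (s e)) \<and> (\<forall>e\<in>M. p (s e) \<le> Suc (q (t e))) \<and>
     (\<forall>e\<in>space E. s e \<notin> s ` M \<longrightarrow> p (s e) = 0) \<and> (\<forall>e\<in>space E. t e \<notin> t ` M \<longrightarrow> k \<le> q (t e))"

lemma labellingD:
  assumes "labelling k M p q"
  shows "e \<in> space E \<Longrightarrow> q (t e) \<le> p (s e)" and "e \<in> M \<Longrightarrow> p (s e) \<le> Suc (q (t e))"
    and "e \<in> space E \<Longrightarrow> s e \<notin> s ` M \<Longrightarrow> p (s e) = 0"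
    and "e \<in> space E \<Longrightarrow> t e \<notin> t ` M \<Longrightarrow> k \<le> q (t e)"
  using assms unfolding labelling_def by auto

end

locale coloured_bigraph = borel_bigraph E s t
  for E :: "'e measure" and s t :: "'e \<Rightarrow> 'v" +
  fixes col :: "'e \<Rightarrow> nat"
  assumes col [measurable]: "col \<in> measurable E (count_space UNIV)"
    and col_s: "\<And>e e'. e \<in> space E \<Longrightarrow> e' \<in> space E \<Longrightarrow> col e = col e' \<Longrightarrow> s e = s e' \<Longrightarrow> e = e'"
    and col_t: "\<And>e e'. e \<in> space E \<Longrightarrow> e' \<in> space E \<Longrightarrow> col e = col e' \<Longrightarrow> t e = t e' \<Longrightarrow> e = e'"
begin

text \<open>
  Fix the colours \<open>n 0, m 0, n 1, m 1, \<dots>, n k\<close> of an alternating walk, where the \<open>m i\<close> are the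
  colours of the matching edges. \<open>fwd n m M i\<close> consists of the \<open>i\<close>-th non-matching edges of walks
  of these colours from an unmatched vertex, and \<open>bwd n m M k j\<close> of the edges from which \<open>j\<close> further
  matching edges lead to an unmatched vertex.
\<close>

primrec fwd :: "(nat \<Rightarrow> nat) \<Rightarrow> (nat \<Rightarrow> nat) \<Rightarrow> 'e set \<Rightarrow> nat \<Rightarrow> 'e set" where
  "fwd n m M 0 = {e \<in> space E. col e = n 0 \<and> s e \<notin> s ` M}"
| "fwd n m M (Suc i) = {e \<in> space E. col e = n (Suc i) \<and>
     s e \<in> s ` {f \<in> M. col f = m i \<and> t f \<in> t ` fwd n m M i}}"

primrec bwd :: "(nat \<Rightarrow> nat) \<Rightarrow> (nat \<Rightarrow> nat) \<Rightarrow> 'e set \<Rightarrow> nat \<Rightarrow> nat \<Rightarrow> 'e set" where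
  "bwd n m M k 0 = {e \<in> space E. col e = n k \<and> t e \<notin> t ` M}"
| "bwd n m M k (Suc j) = {e \<in> space E. col e = n (k - Suc j) \<and>
     t e \<in> t ` {f \<in> M. col f = m (k - Suc j) \<and> s f \<in> s ` bwd n m M k j}}"

text \<open>With all colours prescribed, a walk is determined in both directions by any edge at a
  known position. Hence a forward and a backward condition together describe the complete
  walks.\<close>

definition inserted :: "(nat \<Rightarrow> nat) \<Rightarrow> (nat \<Rightarrow> nat) \<Rightarrow> nat \<Rightarrow> 'e set \<Rightarrow> nat \<Rightarrow> 'e set" where
  "inserted n m k M i = fwd n m M i \<inter> bwd n m M k (k - i)"

definition removed :: "(nat \<Rightarrow> nat) \<Rightarrow> (nat \<Rightarrow> nat) \<Rightarrow> nat \<Rightarrow> 'e set \<Rightarrow> nat \<Rightarrow> 'e set" where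
  "removed n m k M i =
     {f \<in> M. col f = m i \<and> t f \<in> t ` fwd n m M i \<and> s f \<in> s ` bwd n m M k (k - Suc i)}"

definition flip :: "(nat \<Rightarrow> nat) \<Rightarrow> (nat \<Rightarrow> nat) \<Rightarrow> nat \<Rightarrow> 'e set \<Rightarrow> 'e set" where
  "flip n m k M = (M - (\<Union>i<k. removed n m k M i)) \<union> (\<Union>i\<le>k. inserted n m k M i)"

lemma bwd_diff:
  assumes "i < k"
  shows "bwd n m M k (k - i) = {e \<in> space E. col e = n i \<and>
     t e \<in> t ` {f \<in> M. col f = m i \<and> s f \<in> s ` bwd n m M k (k - Suc i)}}"
proof -
  have "k - i = Suc (k - Suc i)" "k - Suc (k - Suc i) = i" using assms by auto
  then show ?thesis by simp
qed

lemma fwd_subset: "fwd n m M i \<subseteq> {e \<in> space E. col e = n i}"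
  by (cases i) auto

lemma bwd_subset: "i \<le> k \<Longrightarrow> bwd n m M k (k - i) \<subseteq> {e \<in> space E. col e = n i}"
  by (cases "i < k") (auto simp: bwd_diff)

lemma fwd_measurable [measurable]: "M \<in> sets E \<Longrightarrow> fwd n m M i \<in> sets E"
  by (induction i) (simp, measurable)+

lemma bwd_measurable [measurable]: "M \<in> sets E \<Longrightarrow> bwd n m M k j \<in> sets E"
  by (induction j) (simp, measurable)+

lemma flip_measurable [measurable]:
  assumes [measurable]: "M \<in> sets E"
  shows "flip n m k M \<in> sets E"
  unfolding flip_def inserted_def removed_def by measurable

text \<open>Used for maximality at the end of a phase: an augmenting walk present when its colour
  word comes up has its starting vertex matched.\<close>

lemma walk_inserted:
  assumes e: "\<And>i. i \<le> k \<Longrightarrow> e i \<in> space E \<and> col (e i) = n i"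
    and start: "s (e 0) \<notin> s ` M" and stop: "t (e k) \<notin> t ` M"
    and f: "\<And>i. i < k \<Longrightarrow> f i \<in> M \<and> col (f i) = m i \<and> t (f i) = t (e i) \<and> s (f i) = s (e (Suc i))"
  shows "e 0 \<in> flip n m k M"
proof -
  have "e j \<in> bwd n m M k (k - j)" if "j \<le> k" for j
    using that
  proof (induction rule: inc_induct)
    case base
    then show ?case using e stop by simp
  next
    case (step j)
    then have "f j \<in> {g \<in> M. col g = m j \<and> s g \<in> s ` bwd n m M k (k - Suc j)}"
      using f[of j] by auto
    moreover have "t (e j) = t (f j)" using f step by simp
    ultimately show ?case using e[of j] step(2) bwd_diff[of j k n m M] by auto
  qed
  from this[of 0] have "e 0 \<in> inserted n m k M 0" using e[of 0] start by (simp add: inserted_def)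
  then show ?thesis unfolding flip_def by blast
qed

section \<open>Effect of one simultaneous augmentation\<close>

context
  fixes n m :: "nat \<Rightarrow> nat" and k :: nat and M :: "'e set" and p q :: "'v \<Rightarrow> nat"
  assumes M: "matching M" and lab: "labelling k M p q"
begin

lemma ME: "e \<in> M \<Longrightarrow> e \<in> space E"
  using M by (auto simp: matching_def)

text \<open>A walk starts at label 0, and only its matching edges can raise the label, by one
  each.\<close>

lemma fwd_label: "e \<in> fwd n m M i \<Longrightarrow> p (s e) \<le> i \<and> q (t e) \<le> i"
proof (induction i arbitrary: e)
  case 0
  then show ?case using labellingD(1,3)[OF lab, of e] by auto
next
  case (Suc i)
  then obtain f e' where f: "f \<in> M" "s e = s f" "t f = t e'" "e' \<in> fwd n m M i" by auto
  have "q (t f) \<le> i" using Suc.IH[OF f(4)] f(3) by simp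
  then have "p (s e) \<le> Suc i" using labellingD(2)[OF lab f(1)] f(2) by simp
  moreover have "q (t e) \<le> p (s e)" using labellingD(1)[OF lab, of e] Suc.prems by auto
  ultimately show ?case by simp
qed

text \<open>Counted back from an unmatched end, where the label is at least \<open>k\<close>, the
  label drops by at most one per matching edge.\<close>

lemma bwd_label: "i \<le> k \<Longrightarrow> e \<in> bwd n m M k (k - i) \<Longrightarrow> i \<le> q (t e) \<and> i \<le> p (s e)"
proof (induction arbitrary: e rule: inc_induct)
  case base
  then show ?case using labellingD(1,4)[OF lab, of e] by auto
next
  case (step i)
  then obtain f e' where f: "f \<in> M" "t e = t f" "s f = s e'" "e' \<in> bwd n m M k (k - Suc i)"
    and e: "e \<in> space E"
    using bwd_diff[of i k] by auto
  have "Suc i \<le> p (s f)" using step.IH[OF f(4)] f(3) by simp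
  then have "i \<le> q (t e)" using labellingD(2)[OF lab f(1)] f(2) by simp
  then show ?case using labellingD(1)[OF lab e] by simp
qed

text \<open>The two bounds meet, so a complete walk has no slack. In particular no edge is inserted
  at two different positions.\<close>

lemma inserted_label:
  "i \<le> k \<Longrightarrow> e \<in> inserted n m k M i \<Longrightarrow> e \<in> space E \<and> col e = n i \<and> p (s e) = i \<and> q (t e) = i"
  using fwd_label[of e i] bwd_label[of i e] fwd_subset[of n m M i] unfolding inserted_def
  by (auto intro: antisym)

lemma removed_label:
  assumes "i < k" and "f \<in> removed n m k M i"
  shows "p (s f) = Suc i \<and> q (t f) = i"
proof -
  from assms(2) obtain e e' where "e \<in> fwd n m M i" "t f = t e"
    "e' \<in> bwd n m M k (k - Suc i)" "s f = s e'" and f: "f \<in> M" by (auto simp: removed_def)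
  then have "q (t f) \<le> i" "Suc i \<le> p (s f)"
    using fwd_label[of e i] bwd_label[of "Suc i" e'] assms(1) by auto
  then show ?thesis using labellingD(2)[OF lab f] by simp
qed

text \<open>This lemma and the next three link neighbouring positions: a matched vertex on a walk
  loses one edge and gains one. Both injectivity and the preservation of covered vertices rest on
  this.\<close>

lemma removed_before:
  assumes "Suc i \<le> k" and "e \<in> inserted n m k M (Suc i)"
  obtains f where "f \<in> removed n m k M i" and "s f = s e"
proof -
  from assms(2) obtain f where f: "f \<in> M" "col f = m i" "t f \<in> t ` fwd n m M i" "s f = s e"
    by (auto simp: inserted_def)
  then have "f \<in> removed n m k M i" using assms(2) by (auto simp: removed_def inserted_def)
  then show thesis using f(4) that by blast
qed

lemma removed_after:
  assumes "i < k" and "e \<in> inserted n m k M i"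
  obtains f where "f \<in> removed n m k M i" and "t f = t e"
proof -
  from assms obtain f where f: "f \<in> M" "col f = m i" "s f \<in> s ` bwd n m M k (k - Suc i)" "t f = t e"
    by (auto simp: inserted_def bwd_diff)
  then have "f \<in> removed n m k M i" using assms(2) by (auto simp: removed_def inserted_def)
  then show thesis using f(4) that by blast
qed

lemma inserted_before:
  assumes "i < k" and "f \<in> removed n m k M i"
  obtains e where "e \<in> inserted n m k M i" and "t e = t f"
proof -
  from assms(2) obtain e where e: "e \<in> fwd n m M i" "t e = t f" by (auto simp: removed_def)
  then have "e \<in> bwd n m M k (k - i)"
    using assms fwd_subset[of n m M i] by (auto simp: bwd_diff removed_def intro!: image_eqI[of _ _ f])
  then show thesis using e that by (auto simp: inserted_def)
qed

lemma inserted_after: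
  assumes "i < k" and "f \<in> removed n m k M i"
  obtains e where "e \<in> inserted n m k M (Suc i)" and "s e = s f"
proof -
  from assms(2) obtain e where e: "e \<in> bwd n m M k (k - Suc i)" "s e = s f"
    by (auto simp: removed_def)
  then have "e \<in> fwd n m M (Suc i)"
    using assms bwd_subset[of "Suc i" k n m M] by (auto simp: removed_def intro!: image_eqI[of _ _ f])
  then show thesis using e that by (auto simp: inserted_def)
qed

text \<open>Two inserted edges at one vertex have the same label, hence the same position and
  colour. An old edge is no rival either: at position 0 the vertex was unmatched, and later its
  matching edge has been removed.\<close>

lemma inserted_s_inj:
  assumes "i \<le> k" "e \<in> inserted n m k M i" "e' \<in> flip n m k M" "s e = s e'"
  shows "e = e'"
proof (cases "\<exists>j\<le>k. e' \<in> inserted n m k M j")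
  case True
  then obtain j where "j \<le> k" "e' \<in> inserted n m k M j" by blast
  then show ?thesis using inserted_label[of i e] inserted_label[of j e'] assms col_s[of e e'] by auto
next
  case False
  then have e': "e' \<in> M" "\<And>j. j < k \<Longrightarrow> e' \<notin> removed n m k M j"
    using assms(3) by (auto simp: flip_def)
  show ?thesis
  proof (cases i)
    case 0
    then have "s e \<notin> s ` M" using assms(2) by (simp add: inserted_def)
    then show ?thesis using e'(1) assms(4) by auto
  next
    case (Suc j)
    then obtain f where f: "f \<in> removed n m k M j" "s f = s e"
      using removed_before[of j e] assms by auto
    then have "f = e'" using M e'(1) assms(4) by (auto simp: matching_def removed_def inj_on_def)
    then show ?thesis using f(1) e'(2)[of j] Suc assms(1) by simp
  qed
qed

lemma inserted_t_inj:
  assumes "i \<le> k" "e \<in> inserted n m k M i" "e' \<in> flip n m k M" "t e = t e'"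
  shows "e = e'"
proof (cases "\<exists>j\<le>k. e' \<in> inserted n m k M j")
  case True
  then obtain j where "j \<le> k" "e' \<in> inserted n m k M j" by blast
  then show ?thesis using inserted_label[of i e] inserted_label[of j e'] assms col_t[of e e'] by auto
next
  case False
  then have e': "e' \<in> M" "\<And>j. j < k \<Longrightarrow> e' \<notin> removed n m k M j"
    using assms(3) by (auto simp: flip_def)
  show ?thesis
  proof (cases "i = k")
    case True
    then have "t e \<notin> t ` M" using assms(2) by (simp add: inserted_def)
    then show ?thesis using e'(1) assms(4) by auto
  next
    case False
    then obtain f where f: "f \<in> removed n m k M i" "t f = t e"
      using removed_after[of i e] assms by auto
    then have "f = e'" using M e'(1) assms(4) by (auto simp: matching_def removed_def inj_on_def)
    then show ?thesis using f(1) e'(2)[of i] False assms(1) by simp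
  qed
qed

lemma flip_cases:
  assumes "e \<in> flip n m k M"
  obtains "e \<in> M" | i where "i \<le> k" "e \<in> inserted n m k M i"
  using assms by (auto simp: flip_def)

lemma matching_flip: "matching (flip n m k M)"
  unfolding matching_def
proof (intro conjI inj_onI)
  show "flip n m k M \<subseteq> space E" using ME inserted_label by (auto elim!: flip_cases)
next
  fix x y assume xy: "x \<in> flip n m k M" "y \<in> flip n m k M" "s x = s y"
  show "x = y"
  proof (cases "\<exists>i\<le>k. x \<in> inserted n m k M i \<or> y \<in> inserted n m k M i")
    case True
    then show ?thesis using xy inserted_s_inj by metis
  next
    case False
    then have "x \<in> M" "y \<in> M" using xy by (auto elim!: flip_cases)
    then show ?thesis using M xy(3) by (auto simp: matching_def inj_on_def)
  qed
next
  fix x y assume xy: "x \<in> flip n m k M" "y \<in> flip n m k M" "t x = t y"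
  show "x = y"
  proof (cases "\<exists>i\<le>k. x \<in> inserted n m k M i \<or> y \<in> inserted n m k M i")
    case True
    then show ?thesis using xy inserted_t_inj by metis
  next
    case False
    then have "x \<in> M" "y \<in> M" using xy by (auto elim!: flip_cases)
    then show ?thesis using M xy(3) by (auto simp: matching_def inj_on_def)
  qed
qed

lemma flip_covers_s: "s ` M \<subseteq> s ` flip n m k M"
proof
  fix x assume "x \<in> s ` M"
  then obtain f where f: "f \<in> M" "x = s f" by blast
  show "x \<in> s ` flip n m k M"
  proof (cases "\<exists>i<k. f \<in> removed n m k M i")
    case True
    then obtain i where i: "i < k" "f \<in> removed n m k M i" by blast
    obtain e where "e \<in> inserted n m k M (Suc i)" "s e = s f" by (rule inserted_after[OF i])
    then show ?thesis using i(1) f(2) by (auto simp: flip_def intro!: image_eqI[of _ _ e])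
  qed (use f in \<open>auto simp: flip_def\<close>)
qed

lemma flip_covers_t: "t ` M \<subseteq> t ` flip n m k M"
proof
  fix x assume "x \<in> t ` M"
  then obtain f where f: "f \<in> M" "x = t f" by blast
  show "x \<in> t ` flip n m k M"
  proof (cases "\<exists>i<k. f \<in> removed n m k M i")
    case True
    then obtain i where i: "i < k" "f \<in> removed n m k M i" by blast
    obtain e where "e \<in> inserted n m k M i" "t e = t f" by (rule inserted_before[OF i])
    then show ?thesis using i(1) f(2) by (auto simp: flip_def intro!: image_eqI[of _ _ e])
  qed (use f in \<open>auto simp: flip_def\<close>)
qed

text \<open>Complementary slackness, together with \<open>flip_lost\<close>.\<close>

lemma flip_gained: "e \<in> flip n m k M \<Longrightarrow> e \<notin> M \<Longrightarrow> p (s e) = q (t e)"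
  using inserted_label by (auto elim!: flip_cases)

lemma flip_lost: "e \<in> M \<Longrightarrow> e \<notin> flip n m k M \<Longrightarrow> p (s e) = Suc (q (t e))"
  using removed_label by (auto simp: flip_def)

text \<open>New edges are tight, and covered vertices stay covered, so the conditions on unmatched
  vertices concern no new ones.\<close>

lemma labelling_flip: "labelling k (flip n m k M) p q"
  unfolding labelling_def
proof (intro conjI ballI impI)
  show "p (s e) \<le> Suc (q (t e))" if "e \<in> flip n m k M" for e
    using that flip_gained[of e] labellingD(2)[OF lab, of e] by fastforce
qed (use labellingD[OF lab] flip_covers_s flip_covers_t in blast)+

end

end

section \<open>Matchings without short augmenting walks\<close>

context coloured_bigraph
begin

text \<open>Forgetting the second component of \<open>prod_decode\<close> makes every word recur at
  arbitrarily late stages.\<close>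

definition colour_word :: "nat \<Rightarrow> nat list \<times> nat list" where
  "colour_word j = from_nat (fst (prod_decode j))"

primrec flips :: "nat \<Rightarrow> 'e set \<Rightarrow> nat \<Rightarrow> 'e set" where
  "flips k M 0 = M"
| "flips k M (Suc j) =
     flip ((!) (fst (colour_word j))) ((!) (snd (colour_word j))) k (flips k M j)"

definition limit_matching :: "nat \<Rightarrow> 'e set \<Rightarrow> 'e set" where
  "limit_matching k M = {e \<in> space E. \<exists>J. \<forall>j\<ge>J. e \<in> flips k M j}"

lemma flips_measurable: "M \<in> sets E \<Longrightarrow> flips k M j \<in> sets E"
  by (induction j) auto

lemma limit_matching_measurable:
  assumes "M \<in> sets E"
  shows "limit_matching k M \<in> sets E"
proof -
  have "limit_matching k M = space E \<inter> (\<Union>J. \<Inter>j\<in>{J..}. flips k M j)"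
    by (auto simp: limit_matching_def)
  also have "\<dots> \<in> sets E"
    using flips_measurable[OF assms] by (intro sets.Int sets.countable_UN sets.countable_INT') auto
  finally show ?thesis .
qed

context
  fixes k :: nat and M :: "'e set" and p q :: "'v \<Rightarrow> nat"
  assumes M: "matching M" and lab: "labelling k M p q"
begin

lemma flips_invariant: "matching (flips k M j) \<and> labelling k (flips k M j) p q"
  by (induction j) (use M lab matching_flip labelling_flip in auto)

lemma flips_covers: "s ` flips k M i \<subseteq> s ` flips k M j \<and> t ` flips k M i \<subseteq> t ` flips k M j"
  if "i \<le> j"
  using that
proof (induction rule: dec_induct)
  case (step j)
  then show ?case using flips_invariant[of j] flip_covers_s flip_covers_t by fastforce
qed simp

text \<open>
  Every edge changes its status at most once: edges with \<open>p (s e) = q (t e)\<close> are never removed and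
  the others are never inserted.
\<close>

lemma flips_convergent:
  assumes e: "e \<in> space E"
  shows "\<exists>J. \<forall>j\<ge>J. e \<in> flips k M j \<longleftrightarrow> e \<in> limit_matching k M"
proof (cases "p (s e) = q (t e)")
  case True
  have stay: "e \<in> flips k M j" if "i \<le> j" "e \<in> flips k M i" for i j
    using that
  proof (induction rule: dec_induct)
    case (step j)
    then show ?case using flips_invariant[of j] flip_lost[of "flips k M j" k p q e] True by fastforce
  qed
  show ?thesis
  proof (cases "\<exists>i. e \<in> flips k M i")
    case True
    then show ?thesis using stay e unfolding limit_matching_def by blast
  qed (auto simp: limit_matching_def)
next
  case False
  have stay: "e \<notin> flips k M j" if "i \<le> j" "e \<notin> flips k M i" for i j
    using that
  proof (induction rule: dec_induct)
    case (step j)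
    then show ?case using flips_invariant[of j] flip_gained[of "flips k M j" k p q e] False by fastforce
  qed
  show ?thesis
  proof (cases "\<exists>i. e \<notin> flips k M i")
    case True
    then obtain i where i: "e \<notin> flips k M i" by blast
    have "e \<notin> limit_matching k M"
    proof
      assume "e \<in> limit_matching k M"
      then obtain J where "\<And>j. j \<ge> J \<Longrightarrow> e \<in> flips k M j" by (auto simp: limit_matching_def)
      then show False using stay[OF _ i, of "max i J"] by simp
    qed
    then show ?thesis using stay[OF _ i] by blast
  qed (use e in \<open>auto simp: limit_matching_def\<close>)
qed

lemma flips_convergent_finite:
  assumes "finite F" and "F \<subseteq> space E"
  shows "\<exists>J. \<forall>j\<ge>J. \<forall>e\<in>F. e \<in> flips k M j \<longleftrightarrow> e \<in> limit_matching k M"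
  using assms
proof (induction rule: finite_induct)
  case (insert e F)
  then obtain J where J: "\<forall>j\<ge>J. \<forall>e\<in>F. e \<in> flips k M j \<longleftrightarrow> e \<in> limit_matching k M" by auto
  obtain J' where "\<forall>j\<ge>J'. e \<in> flips k M j \<longleftrightarrow> e \<in> limit_matching k M"
    using flips_convergent[of e] insert.prems by auto
  then show ?case using J by (intro exI[of _ "max J J'"]) auto
qed simp

text \<open>The edge covering the vertex may change from stage to stage, but its finitely many
  candidates all settle by a common stage.\<close>

lemma limit_matching_covers_s:
  assumes e: "e \<in> space E" "s e \<in> s ` flips k M j"
  shows "s e \<in> s ` limit_matching k M"
proof -
  obtain J where J: "\<forall>j\<ge>J. \<forall>e'\<in>{e' \<in> space E. s e' = s e}. e' \<in> flips k M j \<longleftrightarrow> e' \<in> limit_matching k M"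
    using flips_convergent_finite[OF finite_s[OF e(1)]] by auto
  have "s e \<in> s ` flips k M (max j J)" using e(2) flips_covers[of j "max j J"] by auto
  then obtain e' where "e' \<in> flips k M (max j J)" "s e' = s e" by auto
  moreover from this have "e' \<in> space E" using flips_invariant by (auto simp: matching_def)
  ultimately show ?thesis using J by (auto intro!: image_eqI[of _ _ e'])
qed

lemma limit_matching_covers_t:
  assumes e: "e \<in> space E" "t e \<in> t ` flips k M j"
  shows "t e \<in> t ` limit_matching k M"
proof -
  obtain J where J: "\<forall>j\<ge>J. \<forall>e'\<in>{e' \<in> space E. t e' = t e}. e' \<in> flips k M j \<longleftrightarrow> e' \<in> limit_matching k M"
    using flips_convergent_finite[OF finite_t[OF e(1)]] by auto
  have "t e \<in> t ` flips k M (max j J)" using e(2) flips_covers[of j "max j J"] by auto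
  then obtain e' where "e' \<in> flips k M (max j J)" "t e' = t e" by auto
  moreover from this have "e' \<in> space E" using flips_invariant by (auto simp: matching_def)
  ultimately show ?thesis using J by (auto intro!: image_eqI[of _ _ e'])
qed

lemma matching_limit: "matching (limit_matching k M)"
proof -
  have common: "\<exists>j. x \<in> flips k M j \<and> y \<in> flips k M j"
    if "x \<in> limit_matching k M" "y \<in> limit_matching k M" for x y
    using that unfolding limit_matching_def by (auto intro: max.cobounded1 max.cobounded2)
  show ?thesis
    unfolding matching_def
  proof (intro conjI inj_onI)
    show "limit_matching k M \<subseteq> space E" by (auto simp: limit_matching_def)
    fix x y assume "x \<in> limit_matching k M" "y \<in> limit_matching k M"
    then obtain j where j: "x \<in> flips k M j" "y \<in> flips k M j" using common by blast
    show "x = y" if "s x = s y"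
      using j that flips_invariant[of j] by (auto simp: matching_def inj_on_def)
    show "x = y" if "t x = t y"
      using j that flips_invariant[of j] by (auto simp: matching_def inj_on_def)
  qed
qed

lemma labelling_limit: "labelling k (limit_matching k M) p q"
  unfolding labelling_def
proof (intro conjI ballI impI)
  fix e assume e: "e \<in> space E"
  show "q (t e) \<le> p (s e)" using labellingD(1)[OF lab e] .
  show "p (s e) = 0" if "s e \<notin> s ` limit_matching k M"
    using labellingD(3)[OF lab e] limit_matching_covers_s[OF e, of 0] that by auto
  show "k \<le> q (t e)" if "t e \<notin> t ` limit_matching k M"
    using labellingD(4)[OF lab e] limit_matching_covers_t[OF e, of 0] that by auto
next
  fix e assume "e \<in> limit_matching k M"
  then obtain j where "e \<in> flips k M j" by (auto simp: limit_matching_def)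
  then show "p (s e) \<le> Suc (q (t e))" using flips_invariant[of j] labellingD(2) by blast
qed

text \<open>The matching edges of such a walk are in place from some stage on, and its ends,
  unmatched in the limit, are unmatched at every stage. So it is augmented when its word next comes
  up.\<close>

lemma no_augmenting_walk:
  assumes e: "\<And>i. i \<le> k \<Longrightarrow> e i \<in> space E"
    and start: "s (e 0) \<notin> s ` limit_matching k M" and stop: "t (e k) \<notin> t ` limit_matching k M"
    and f: "\<And>i. i < k \<Longrightarrow> f i \<in> limit_matching k M \<and> t (f i) = t (e i) \<and> s (f i) = s (e (Suc i))"
  shows False
proof -
  define w where "w = (map (col \<circ> e) [0..<Suc k], map (col \<circ> f) [0..<k])"
  have "f ` {..<k} \<subseteq> space E" using f by (auto simp: limit_matching_def)
  then obtain J where J: "\<forall>j\<ge>J. \<forall>g\<in>f ` {..<k}. g \<in> flips k M j \<longleftrightarrow> g \<in> limit_matching k M"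
    using flips_convergent_finite[of "f ` {..<k}"] by blast
  \<comment> \<open>The second component \<open>J\<close> pushes the stage beyond the settling of
    all matching edges of the walk.\<close>
  define j where "j = prod_encode (to_nat w, J)"
  have "J \<le> j" unfolding j_def by (rule le_prod_encode_2)
  have word: "colour_word j = w" by (simp add: colour_word_def j_def)
  have "e 0 \<in> flips k M (Suc j)"
    unfolding flips.simps word
  proof (rule walk_inserted)
    show "e i \<in> space E \<and> col (e i) = fst w ! i" if "i \<le> k" for i
      using e that by (simp add: w_def nth_append del: upt_Suc)
    show "s (e 0) \<notin> s ` flips k M j" using limit_matching_covers_s[OF e, of 0] start by auto
    show "t (e k) \<notin> t ` flips k M j" using limit_matching_covers_t[OF e, of k] stop by auto
    show "f i \<in> flips k M j \<and> col (f i) = snd w ! i \<and> t (f i) = t (e i) \<and> s (f i) = s (e (Suc i))"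
      if "i < k" for i
      using f[OF that] J \<open>J \<le> j\<close> that by (auto simp: w_def)
  qed
  from limit_matching_covers_s[OF e[of 0] imageI[OF this]]
  have "s (e 0) \<in> s ` limit_matching k M" by simp
  then show False using start by blast
qed

text \<open>The Hungarian forest: vertices reached from unmatched ones by alternating walks on which
  every label inequality is an equality. The index is the label.\<close>

primrec tight :: "nat \<Rightarrow> 'v set" where
  "tight 0 = {s e | e. e \<in> space E \<and> s e \<notin> s ` limit_matching k M}"
| "tight (Suc i) = {s f | f. f \<in> limit_matching k M \<and> p (s f) = Suc i \<and>
     (\<exists>e\<in>space E. t e = t f \<and> s e \<in> tight i \<and> q (t e) = i)}"

definition tight_t :: "nat \<Rightarrow> 'v set" where
  "tight_t i = {t e | e. e \<in> space E \<and> s e \<in> tight i \<and> q (t e) = i}"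

lemma tight_label: "x \<in> tight i \<Longrightarrow> p x = i"
  using labellingD(3)[OF labelling_limit] by (cases i) auto

lemma tight_walk:
  "e0 \<in> space E \<Longrightarrow> s e0 \<in> tight i \<Longrightarrow> \<exists>e f. (\<forall>j\<le>i. e j \<in> space E) \<and>
     s (e 0) \<notin> s ` limit_matching k M \<and> e i = e0 \<and>
     (\<forall>j<i. f j \<in> limit_matching k M \<and> t (f j) = t (e j) \<and> s (f j) = s (e (Suc j)))"
proof (induction i arbitrary: e0)
  case 0
  then obtain e where "s e0 = s e" "s e \<notin> s ` limit_matching k M" by auto
  then have "s e0 \<notin> s ` limit_matching k M" by simp
  then show ?case using 0 by (intro exI[of _ "\<lambda>_. e0"]) simp
next
  case (Suc i)
  then obtain f0 e1 where f0: "f0 \<in> limit_matching k M" "s f0 = s e0" "t e1 = t f0"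
    and e1: "e1 \<in> space E" "s e1 \<in> tight i" by auto
  obtain e f where ef: "\<forall>j\<le>i. e j \<in> space E" "s (e 0) \<notin> s ` limit_matching k M" "e i = e1"
    "\<forall>j<i. f j \<in> limit_matching k M \<and> t (f j) = t (e j) \<and> s (f j) = s (e (Suc j))"
    using Suc.IH[OF e1] by blast
  define e' where "e' j = (if j = Suc i then e0 else e j)" for j
  define f' where "f' j = (if j = i then f0 else f j)" for j
  have "e' j \<in> space E" if "j \<le> Suc i" for j
    using that ef(1) Suc.prems(1) by (simp add: e'_def)
  moreover have "s (e' 0) \<notin> s ` limit_matching k M" using ef(2) by (simp add: e'_def)
  moreover have "e' (Suc i) = e0" by (simp add: e'_def)
  moreover have "f' j \<in> limit_matching k M \<and> t (f' j) = t (e' j) \<and> s (f' j) = s (e' (Suc j))"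
    if "j < Suc i" for j
    using that ef(3,4) f0 by (cases "j = i") (simp_all add: e'_def f'_def)
  ultimately show ?case by blast
qed

text \<open>Otherwise a tight walk to \<open>y\<close> would be an augmenting walk of exactly the
  length exhausted in this phase.\<close>

lemma tight_t_matched:
  assumes "y \<in> tight_t k"
  shows "y \<in> t ` limit_matching k M"
proof (rule ccontr)
  assume y: "y \<notin> t ` limit_matching k M"
  from assms obtain e0 where e0: "e0 \<in> space E" "s e0 \<in> tight k" "y = t e0"
    by (auto simp: tight_t_def)
  obtain e f where "\<forall>j\<le>k. e j \<in> space E" "s (e 0) \<notin> s ` limit_matching k M" "e k = e0"
    "\<forall>j<k. f j \<in> limit_matching k M \<and> t (f j) = t (e j) \<and> s (f j) = s (e (Suc j))"
    using tight_walk[OF e0(1,2)] by blast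
  then show False using no_augmenting_walk[of e f] y e0(3) by blast
qed

text \<open>The dual update of the Hungarian method.\<close>

lemma relabelling:
  "labelling (Suc k) (limit_matching k M)
     (\<lambda>x. if x \<in> (\<Union>i. tight i) then p x else Suc (p x))
     (\<lambda>y. if y \<in> (\<Union>i. tight_t i) then q y else Suc (q y))"
  (is "labelling _ _ ?p ?q")
proof -
  note lab' = labellingD[OF labelling_limit]
  have step_t: "t e \<in> tight_t i" if "e \<in> space E" "s e \<in> tight i" "q (t e) = i" for e i
    using that by (auto simp: tight_t_def)
  have step_s: "s f \<in> tight (Suc i)" if f: "f \<in> limit_matching k M" "t f \<in> tight_t i" "p (s f) = Suc i" for f i
  proof -
    obtain e where "e \<in> space E" "t e = t f" "s e \<in> tight i" "q (t e) = i"
      using f(2) by (auto simp: tight_t_def)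
    then show ?thesis unfolding tight.simps using f by blast
  qed
  have label_t: "q y = i" if "y \<in> tight_t i" for y i using that by (auto simp: tight_t_def)
  define P where "P = ?p"
  define Q where "Q = ?q"
  have P: "x \<in> tight i \<Longrightarrow> P x = i" "(\<And>i. x \<notin> tight i) \<Longrightarrow> P x = Suc (p x)" for x i
    using tight_label[of x i] by (auto simp: P_def)
  have Q: "y \<in> tight_t i \<Longrightarrow> Q y = i" "(\<And>i. y \<notin> tight_t i) \<Longrightarrow> Q y = Suc (q y)" for y i
    using label_t[of y i] by (auto simp: Q_def)
  have P_le: "P x \<le> Suc (p x)" and Q_le: "Q x \<le> Suc (q x)" for x by (auto simp: P_def Q_def)
  have "labelling (Suc k) (limit_matching k M) P Q"
    unfolding labelling_def
  proof (intro conjI ballI impI)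
    fix e assume e: "e \<in> space E"
    \<comment> \<open>The critical case keeps \<open>p (s e)\<close> fixed: on an edge without slack
      \<open>q (t e)\<close> is then fixed too, and slack leaves room for raising it by one.\<close>
    show "Q (t e) \<le> P (s e)"
    proof (cases "\<exists>i. s e \<in> tight i")
      case True
      then obtain i where i: "s e \<in> tight i" by blast
      have "Q (t e) \<le> i"
      proof (cases "q (t e) = i")
        case True
        then show ?thesis using Q(1)[OF step_t[OF e i]] by simp
      next
        case False
        then show ?thesis using lab'(1)[OF e] tight_label[OF i] Q_le[of "t e"] by simp
      qed
      then show ?thesis using P(1)[OF i] by simp
    next
      case False
      then have "P (s e) = Suc (p (s e))" using P(2) by blast
      then show ?thesis using lab'(1)[OF e] Q_le[of "t e"] by simp
    qed
    show "P (s e) = 0" if "s e \<notin> s ` limit_matching k M"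
      by (rule P(1)) (use e that in auto)
    show "Suc k \<le> Q (t e)" if "t e \<notin> t ` limit_matching k M"
    proof (cases "\<exists>i. t e \<in> tight_t i")
      case True
      then obtain i where i: "t e \<in> tight_t i" by blast
      \<comment> \<open>The unraised label \<open>i\<close> is at least \<open>k\<close>, so
        excluding \<open>k\<close> gives the new bound.\<close>
      then have "i \<noteq> k" using tight_t_matched that by blast
      then show ?thesis using lab'(4)[OF e that] label_t[OF i] Q(1)[OF i] by simp
    next
      case False
      then have "Q (t e) = Suc (q (t e))" using Q(2) by blast
      then show ?thesis using lab'(4)[OF e that] by simp
    qed
  next
    fix f assume f: "f \<in> limit_matching k M"
    show "P (s f) \<le> Suc (Q (t f))"
    proof (cases "\<exists>i. t f \<in> tight_t i")
      case True
      then obtain i where i: "t f \<in> tight_t i" by blast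
      have "P (s f) \<le> Suc i"
      proof (cases "p (s f) = Suc i")
        case True
        then show ?thesis using P(1)[OF step_s[OF f i]] by simp
      next
        case False
        then show ?thesis using lab'(2)[OF f] label_t[OF i] P_le[of "s f"] by simp
      qed
      then show ?thesis using Q(1)[OF i] by simp
    next
      case False
      then have "Q (t f) = Suc (q (t f))" using Q(2) by blast
      then show ?thesis using lab'(2)[OF f] P_le[of "s f"] by simp
    qed
  qed
  then show ?thesis unfolding P_def Q_def .
qed

end

theorem ex_labelled_matching:
  "\<exists>M p q. M \<in> sets E \<and> matching M \<and> labelling k M p q"
proof (induction k)
  case 0
  have "{} \<in> sets E \<and> matching {} \<and> labelling 0 {} (\<lambda>_. 0) (\<lambda>_. 0)"
    by (simp add: matching_def labelling_def)
  then show ?case by (intro exI)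
next
  case (Suc k)
  then obtain M p q where M: "M \<in> sets E" "matching M" "labelling k M p q" by blast
  show ?case
    by (rule exI, rule exI, rule exI, rule conjI[OF limit_matching_measurable[OF M(1)]
          conjI[OF matching_limit[OF M(2,3)] relabelling[OF M(2,3)]]])
qed

end

context borel_bigraph
begin

text \<open>
  From an unmatched vertex the sets of vertices reached by alternating walks grow by the
  factor \<open>c\<close> as long as all the neighbours are matched, which the labelling guarantees for \<open>k\<close>
  steps.
\<close>

lemma alternating_growth:
  fixes c :: real
  assumes M: "matching M" and lab: "labelling k M p q"
    and c: "c \<ge> 0" and expand: "\<And>S. finite S \<Longrightarrow> S \<subseteq> s ` space E \<Longrightarrow>
      finite (t ` {e \<in> space E. s e \<in> S}) \<and> c * card S \<le> card (t ` {e \<in> space E. s e \<in> S})"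
    and a: "a \<in> s ` space E" "a \<notin> s ` M"
    and adj: "\<And>e f. e \<in> space E \<Longrightarrow> f \<in> space E \<Longrightarrow> t e = t f \<Longrightarrow> (s e, s f) \<in> R ^^ 2"
  shows "i \<le> k \<Longrightarrow> \<exists>S. finite S \<and> S \<subseteq> s ` space E \<and> (\<forall>x\<in>S. p x \<le> i) \<and>
    c ^ i \<le> card S \<and> (\<forall>x\<in>S. (a, x) \<in> R ^^ (2 * i))"
proof (induction i)
  case 0
  obtain e where "e \<in> space E" "a = s e" using a(1) by blast
  then have "p a = 0" using labellingD(3)[OF lab, of e] a(2) by simp
  then have "finite {a} \<and> {a} \<subseteq> s ` space E \<and> (\<forall>x\<in>{a}. p x \<le> 0) \<and>
    c ^ 0 \<le> card {a} \<and> (\<forall>x\<in>{a}. (a, x) \<in> R ^^ (2 * 0))"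
    using a(1) by simp
  then show ?case by (rule exI)
next
  case (Suc i)
  from Suc.prems have "i \<le> k" by simp
  from Suc.IH[OF this] obtain S where S: "finite S" "S \<subseteq> s ` space E" "\<forall>x\<in>S. p x \<le> i"
    "c ^ i \<le> card S" "\<forall>x\<in>S. (a, x) \<in> R ^^ (2 * i)" by blast
  define T where "T = t ` {e \<in> space E. s e \<in> S}"
  define F where "F = {f \<in> M. t f \<in> T}"
  have T: "finite T" "c * card S \<le> card T" using expand[OF S(1,2)] by (auto simp: T_def)
  have ME: "M \<subseteq> space E" and inj: "inj_on s M" "inj_on t M" using M by (auto simp: matching_def)
  have q: "q y \<le> i" if "y \<in> T" for y
    using that labellingD(1)[OF lab] S(3) unfolding T_def by fastforce
  have "T \<subseteq> t ` F"
  proof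
    fix y assume y: "y \<in> T"
    then obtain e where e: "e \<in> space E" "y = t e" by (auto simp: T_def)
    \<comment> \<open>An unmatched \<open>y\<close> would have label at least \<open>k\<close>,
      whereas \<open>q y \<le> i < k\<close>.\<close>
    have "y \<in> t ` M"
      using labellingD(4)[OF lab e(1)] q[OF y] e(2) Suc.prems by force
    then show "y \<in> t ` F" using y by (auto simp: F_def)
  qed
  then have tF: "t ` F = T" by (auto simp: F_def)
  have injF: "inj_on t F" "inj_on s F" using inj by (auto simp: F_def inj_on_def)
  have finF: "finite F" using finite_imageD[of t F] injF tF T by simp
  have card: "card (s ` F) = card T" using card_image[OF injF(1)] card_image[OF injF(2)] tF by simp
  have "c ^ Suc i \<le> c * card S" using S(4) c by (simp add: mult_left_mono)
  also have "\<dots> \<le> card (s ` F)" using T(2) card by simp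
  finally have grow: "c ^ Suc i \<le> card (s ` F)" .
  have "p (s f) \<le> Suc i \<and> (a, s f) \<in> R ^^ (2 * Suc i)" if f: "f \<in> F" for f
  proof
    have "f \<in> M" "t f \<in> T" using f by (auto simp: F_def)
    then show "p (s f) \<le> Suc i" using labellingD(2)[OF lab, of f] q[of "t f"] by simp
    obtain e where e: "e \<in> space E" "s e \<in> S" "t e = t f" using \<open>t f \<in> T\<close> by (auto simp: T_def)
    have "(s e, s f) \<in> R ^^ 2" using adj e \<open>f \<in> M\<close> ME by blast
    then have "(a, s f) \<in> R ^^ (2 * i + 2)" using S(5) e(2) unfolding relpow_add by blast
    then show "(a, s f) \<in> R ^^ (2 * Suc i)" by (simp add: mult.commute)
  qed
  then show ?case
    using finF ME grow by (intro exI[of _ "s ` F"]) (auto simp: F_def)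
qed

end

section \<open>Borel endpoint maps and the comparison of growth rates\<close>

lemma unordered_pairs_between:
  assumes "A \<in> sets V" "B \<in> sets V" "A \<inter> B = {}"
  shows "{{x, y} | x y. x \<in> A \<and> y \<in> B} \<in> sets (unordered_pairs V)" (is "?U \<in> _")
proof -
  have sp: "A \<subseteq> space V" "B \<subseteq> space V" using assms sets.sets_into_space by auto
  have "(\<lambda>(x, y). {x, y}) -` ?U \<inter> space (distinct_pairs V) =
      {(x, y). x \<noteq> y} \<inter> (A \<times> B \<union> B \<times> A)"
    using assms(3) sp
    by (auto simp: distinct_pairs_def space_restrict_space space_pair_measure doubleton_eq_iff)
  also have "\<dots> \<in> sets (distinct_pairs V)"
    unfolding distinct_pairs_def sets_restrict_space using assms(1,2) by (intro imageI) auto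
  finally show ?thesis using assms(3) sp unfolding sets_unordered_pairs by blast
qed

text \<open>Disjointness of the sides recovers an endpoint from the unordered pair:
  \<open>s e \<in> D\<close> says that \<open>\<pi> e\<close> joins \<open>A \<inter> D\<close> to
  \<open>B\<close>. Swapping the sides gives the other endpoint.\<close>

lemma endpoint_measurable:
  assumes pi: "\<pi> \<in> measurable E (unordered_pairs V)"
    and AB: "A \<in> sets V" "B \<in> sets V" "A \<inter> B = {}"
    and ends: "\<And>e. e \<in> space E \<Longrightarrow> \<exists>b\<in>B. s e \<in> A \<and> \<pi> e = {s e, b}"
  shows "s \<in> measurable E V"
proof (rule measurableI)
  show "s e \<in> space V" if "e \<in> space E" for e
    using ends[OF that] AB(1) sets.sets_into_space by blast
  fix D assume D: "D \<in> sets V"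
  have "s -` D \<inter> space E = \<pi> -` {{x, y} | x y. x \<in> A \<inter> D \<and> y \<in> B} \<inter> space E"
  proof (intro set_eqI iffI)
    fix e assume "e \<in> s -` D \<inter> space E"
    then show "e \<in> \<pi> -` {{x, y} | x y. x \<in> A \<inter> D \<and> y \<in> B} \<inter> space E" using ends[of e] by auto
  next
    fix e assume e: "e \<in> \<pi> -` {{x, y} | x y. x \<in> A \<inter> D \<and> y \<in> B} \<inter> space E"
    then obtain x y where "\<pi> e = {x, y}" "x \<in> A \<inter> D" "y \<in> B" "e \<in> space E" by auto
    then show "e \<in> s -` D \<inter> space E"
      using ends[of e] AB(3) by (auto simp: doubleton_eq_iff)
  qed
  also have "\<dots> \<in> sets E"
    using D AB by (intro measurable_sets[OF pi] unordered_pairs_between) auto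
  finally show "s -` D \<inter> space E \<in> sets E" .
qed

theorem theorem1p9:
  fixes V :: "'v measure" and E :: "'e measure" and \<pi> :: "'e \<Rightarrow> 'v set" and A B :: "'v set"
  assumes "borel_graph V E \<pi>"
    and "locally_finite_graph V E \<pi>"
    and "borel_bipartition V E \<pi> A B"
    and "combinatorial_expansion E \<pi> A"
    and "subexponential_growth V E \<pi>"
  shows "\<exists>M. borel_matching E \<pi> M \<and> matching_covers \<pi> M A"
proof -
  have V: "standard_borel V" and E: "standard_borel E" and pi: "\<pi> \<in> measurable E (unordered_pairs V)"
    using assms(1) by (auto simp: borel_graph_def)
  have AB: "A \<in> sets V" "B \<in> sets V" "A \<union> B = space V" "A \<inter> B = {}"
    and "\<forall>e\<in>space E. \<exists>a\<in>A. \<exists>b\<in>B. \<pi> e = {a, b}"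
    using assms(3) unfolding borel_bipartition_def by auto
  then obtain s t where st: "\<And>e. e \<in> space E \<Longrightarrow> s e \<in> A"
    "\<And>e. e \<in> space E \<Longrightarrow> t e \<in> B" "\<And>e. e \<in> space E \<Longrightarrow> \<pi> e = {s e, t e}" by metis
  have s_meas: "s \<in> measurable E V"
    by (rule endpoint_measurable[OF pi, of A B]) (use AB st in auto)
  have t_meas: "t \<in> measurable E V"
    by (rule endpoint_measurable[OF pi, of B A]) (use AB st in \<open>auto simp: insert_commute\<close>)
  have fin: "finite {e \<in> space E. x \<in> \<pi> e}" if "x \<in> space V" for x
    using assms(2) that by (auto simp: locally_finite_graph_def)
  have fin_s: "finite {e \<in> space E. s e = x}" if "x \<in> space V" for x
    using fin[OF that] by (rule rev_finite_subset) (use st in auto)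
  have fin_t: "finite {e \<in> space E. t e = x}" if "x \<in> space V" for x
    using fin[OF that] by (rule rev_finite_subset) (use st in auto)
  have s_V: "s e \<in> space V" and t_V: "t e \<in> space V" if "e \<in> space E" for e
    using measurable_space[OF s_meas that] measurable_space[OF t_meas that] .
  interpret borel_bigraph E s t
  proof
    fix Q assume Q: "Q \<in> sets E"
    have "s -` (s ` Q) \<inter> space E \<in> sets E"
      by (rule measurable_sets[OF s_meas finite_to_one_image_measurable[OF E V s_meas fin_s Q]])
    then show "{e \<in> space E. s e \<in> s ` Q} \<in> sets E" by (simp add: vimage_def Int_def conj_commute)
    have "t -` (t ` Q) \<inter> space E \<in> sets E"
      by (rule measurable_sets[OF t_meas finite_to_one_image_measurable[OF E V t_meas fin_t Q]])
    then show "{e \<in> space E. t e \<in> t ` Q} \<in> sets E" by (simp add: vimage_def Int_def conj_commute)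
  qed (use fin_s fin_t s_V t_V in auto)
  obtain C :: "nat \<Rightarrow> 'e set" and c0 :: "nat \<Rightarrow> 'e \<Rightarrow> nat"
    where c0: "complete_coding E c0" "\<And>j. decides E c0 (C j)"
    and sep: "\<And>x y. x \<in> space E \<Longrightarrow> y \<in> space E \<Longrightarrow> (\<And>j. x \<in> C j \<longleftrightarrow> y \<in> C j) \<Longrightarrow> x = y"
    by (rule standard_borel_base[OF E]) blast
  obtain col :: "'e \<Rightarrow> nat" where col: "col \<in> measurable E (count_space UNIV)"
    "\<And>e e'. e \<in> space E \<Longrightarrow> e' \<in> space E \<Longrightarrow> col e = col e' \<Longrightarrow> s e = s e' \<Longrightarrow> e = e'"
    "\<And>e e'. e \<in> space E \<Longrightarrow> e' \<in> space E \<Longrightarrow> col e = col e' \<Longrightarrow> t e = t e' \<Longrightarrow> e = e'"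
    by (rule ex_edge_colouring[of C]) (use decides_sets[OF c0] sep in blast)+
  interpret coloured_bigraph E s t col
    by unfold_locales (use col in auto)
  from assms(4) obtain c :: real where c: "c > 1"
    "\<And>S. finite S \<Longrightarrow> S \<subseteq> A \<Longrightarrow> infinite (neighborhood E \<pi> S) \<or>
       real (card (neighborhood E \<pi> S)) \<ge> c * real (card S)"
    unfolding combinatorial_expansion_def by blast
  have nbh: "neighborhood E \<pi> S = t ` {e \<in> space E. s e \<in> S}" if "S \<subseteq> A" for S
    using that st AB(4) by (fastforce simp: neighborhood_def neighbors_def doubleton_eq_iff)
  have expand: "finite (t ` {e \<in> space E. s e \<in> S}) \<and> c * card S \<le> card (t ` {e \<in> space E. s e \<in> S})"
    if S: "finite S" "S \<subseteq> A" for S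
  proof -
    have "{e \<in> space E. s e \<in> S} = (\<Union>x\<in>S. {e \<in> space E. s e = x})" by auto
    moreover have "finite (\<Union>x\<in>S. {e \<in> space E. s e = x})"
      using S AB(3) by (intro finite_UN_I fin_s) auto
    ultimately show ?thesis using c(2)[OF S] nbh[OF S(2)] by simp
  qed
  have A_s: "A \<subseteq> s ` space E"
  proof
    fix a assume a: "a \<in> A"
    \<comment> \<open>Expansion of a singleton excludes isolated vertices in
      \<open>A\<close>.\<close>
    define X where "X = t ` {e \<in> space E. s e \<in> {a}}"
    have "c \<le> card X" using expand[of "{a}"] a by (simp add: X_def)
    then have "X \<noteq> {}" using c(1) by auto
    then have "{e \<in> space E. s e \<in> {a}} \<noteq> {}" by (simp add: X_def)
    then show "a \<in> s ` space E" by auto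
  qed
  define R where "R = {(u, v). v \<in> neighbors E \<pi> u}"
  have adj: "(s e, s f) \<in> R ^^ 2" if "e \<in> space E" "f \<in> space E" "t e = t f" for e f
  proof -
    have "(s e, t e) \<in> R" "(t f, s f) \<in> R"
      using st(3)[OF that(1)] st(3)[OF that(2)] that(1,2)
      by (auto simp: R_def neighbors_def insert_commute)
    then show ?thesis using that(3) by (auto simp: numeral_2_eq_2)
  qed
  \<comment> \<open>Walks with \<open>k\<close> matching edges have length \<open>2 * k\<close>, and
    this choice makes \<open>exp (\<epsilon> * (2 * k))\<close> the square root of
    \<open>c ^ k\<close>.\<close>
  define \<epsilon> where "\<epsilon> = ln c / 4"
  have "\<epsilon> > 0" using c(1) by (simp add: \<epsilon>_def)
  then obtain R0 where R0: "\<And>r x. r \<ge> R0 \<Longrightarrow> x \<in> space V \<Longrightarrow>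
      finite (graph_ball E \<pi> x r) \<and> real (card (graph_ball E \<pi> x r)) \<le> exp (\<epsilon> * r)"
    using assms(5) unfolding subexponential_growth_def by blast
  \<comment> \<open>\<open>k \<ge> 1\<close> makes the final comparison strict, and
    \<open>k \<ge> R0\<close> gives \<open>2 * k \<ge> R0\<close>.\<close>
  obtain k :: nat where k: "k \<ge> 1" "real k \<ge> R0"
    using real_arch_simple[of "max 1 R0"] by auto
  obtain M p q where M: "M \<in> sets E" "matching M" "labelling k M p q"
    using ex_labelled_matching by blast
  have "A \<subseteq> s ` M"
  proof
    fix a assume a: "a \<in> A"
    show "a \<in> s ` M"
    proof (rule ccontr)
      assume "a \<notin> s ` M"
      have "\<exists>S. finite S \<and> S \<subseteq> s ` space E \<and> (\<forall>x\<in>S. p x \<le> k) \<and>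
          c ^ k \<le> card S \<and> (\<forall>x\<in>S. (a, x) \<in> R ^^ (2 * k))"
      proof (rule alternating_growth[OF M(2,3)])
        show "finite (t ` {e \<in> space E. s e \<in> S}) \<and> c * card S \<le> card (t ` {e \<in> space E. s e \<in> S})"
          if "finite S" "S \<subseteq> s ` space E" for S
          using expand[OF that(1)] that(2) st(1) by blast
      qed (use c(1) A_s a \<open>a \<notin> s ` M\<close> adj in auto)
      then obtain S where S: "finite S" "c ^ k \<le> card S" "\<forall>x\<in>S. (a, x) \<in> R ^^ (2 * k)"
        by blast
      define ball where "ball = graph_ball E \<pi> a (2 * real k)"
      have ball: "finite ball" "card ball \<le> exp (\<epsilon> * (2 * real k))"
        using R0[of "2 * real k" a] k a AB(3) by (auto simp: ball_def)
      have "S \<subseteq> ball"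
        using S(3) unfolding ball_def graph_ball_def R_def[symmetric]
        by (auto intro!: exI[of _ "2 * k"])
      then have "card S \<le> card ball" using ball(1) by (rule card_mono[rotated])
      then have "c ^ k \<le> exp (\<epsilon> * (2 * real k))" using S(2) ball(2) by linarith
      also have "\<dots> < exp (ln c * real k)"
        using c(1) k(1) by (simp add: \<epsilon>_def)
      also have "\<dots> = c ^ k"
        using c(1) by (simp add: exp_of_nat2_mult)
      finally show False by simp
    qed
  qed
  then have "matching_covers \<pi> M A"
    using M(2) st(3) unfolding matching_covers_def matching_def by fastforce
  moreover have "borel_matching E \<pi> M"
    unfolding borel_matching_def pairwise_def
  proof (intro conjI ballI impI)
    fix e f assume ef: "e \<in> M" "f \<in> M" "e \<noteq> f"
    then have E: "e \<in> space E" "f \<in> space E" and "s e \<noteq> s f" "t e \<noteq> t f"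
      using M(2) by (auto simp: matching_def inj_on_def)
    moreover have "s e \<noteq> t f" "t e \<noteq> s f" using st(1,2)[OF E(1)] st(1,2)[OF E(2)] AB(4) by auto
    ultimately show "disjnt (\<pi> e) (\<pi> f)" using st(3) by (auto simp: disjnt_def)
  qed (rule M(1))
  ultimately show ?thesis by blast
qed

end
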